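(* Let $\Phi:(0,\infty)\to[0,\infty)$ be any compactly supported smooth weight function, not identically zero. For $\Xi\ge0$ let $$M(\Xi)=\bar c\sum_{1\le y<2\sqrt\Xi}\frac{11\zeta(2)}{4A}\sqrt{\frac{\Xi}{4\Xi-y^2}}\;\kappa(y)-\frac{11\pi}{12A}\sqrt\Xi$$ and let $$M_\Phi(\Xi)=\frac{\int_0^\infty M(\Xi/u)\,\Phi(u)\,u^{3/2}\,\frac{du}{u}}{\int_0^\infty\Phi(u)\,u^{3/2}\,\frac{du}{u}}.$$ Then $$M_\Phi(0)=0\qquad\text{and}\qquad\lim_{\Xi\to\infty}M_\Phi(\Xi)=-\frac12.$$
   Context: The constants and arithmetic function are $$\bar c=\frac13\prod_{\ell>2\text{ prime}}\left(1-\ell^{-2}-\frac{\ell^{-3}}{1-\ell^{-2}}\right),\qquad A=\prod_{q\text{ prime}}\left(1+\frac{q}{(q+1)^2(q-1)}\right),$$ $$\kappa(y)=2^{\mathbf 1\{2\mid y\}}\prod_{q\mid y,\ q\text{ odd prime}}\left(1+\frac{q^2}{q^4-2q^2-q+1}\right)\quad(y\ge1),$$ where $\mathbf 1\{2\mid y\}$ equals $1$ if $y$ is even and $0$ otherwise. The sum over $y$ in $M(\Xi)$ is over integers (empty if $\Xi\le 1/4$). Compactly supported means the support is a compact subset of $(0,\infty)$. *)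

theory Defs
  imports
    "HOL-Analysis.Analysis"
    "HOL-Computational_Algebra.Primes"
begin

definition zeta_real :: "real \<Rightarrow> real" where
  "zeta_real s = (\<Sum>n. 1 / real (Suc n) powr s)"

text \<open>Products over the primes are written as products over all naturals, with factor 1 at
  the indices that do not occur.\<close>

definition c_bar :: real where
  "c_bar = 1 / 3 * (\<Prod>l::nat. if prime l \<and> l > 2
     then 1 - 1 / real l ^ 2 - (1 / real l ^ 3) / (1 - 1 / real l ^ 2) else 1)"

definition A_const :: real where
  "A_const = (\<Prod>q::nat. if prime q
     then 1 + real q / ((real q + 1) ^ 2 * (real q - 1)) else 1)"

definition kappa :: "nat \<Rightarrow> real" where
  "kappa y = 2 ^ (if even y then 1 else 0) *
     (\<Prod>q | prime q \<and> odd q \<and> q dvd y.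
        1 + real q ^ 2 / (real q ^ 4 - 2 * real q ^ 2 - real q + 1))"

definition M_fun :: "real \<Rightarrow> real" where
  "M_fun \<Xi> =
     c_bar * (\<Sum>y::nat | 1 \<le> y \<and> real y < 2 * sqrt \<Xi>.
        11 * zeta_real 2 / (4 * A_const) * sqrt (\<Xi> / (4 * \<Xi> - real y ^ 2)) * kappa y)
     - 11 * pi / (12 * A_const) * sqrt \<Xi>"

definition M_weighted :: "(real \<Rightarrow> real) \<Rightarrow> real \<Rightarrow> real" where
  "M_weighted \<Phi> \<Xi> =
     (LBINT u:{0<..}. M_fun (\<Xi> / u) * \<Phi> u * u powr (3 / 2) / u) /
     (LBINT u:{0<..}. \<Phi> u * u powr (3 / 2) / u)"

definition smooth_on_open :: "real set \<Rightarrow> (real \<Rightarrow> real) \<Rightarrow> bool" where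
  "smooth_on_open S f \<longleftrightarrow> open S \<and> (\<forall>n. (deriv ^^ n) f differentiable_on S)"

text \<open>A function on the positive half-line is represented by a total function whose values at
  nonpositive arguments are irrelevant. The closure is taken in the whole line; that it lies in
  the half-line excludes weights whose support accumulates at 0.\<close>

definition compact_support_pos :: "(real \<Rightarrow> real) \<Rightarrow> bool" where
  "compact_support_pos f \<longleftrightarrow>
     compact (closure {x \<in> {0<..}. f x \<noteq> 0}) \<and> closure {x \<in> {0<..}. f x \<noteq> 0} \<subseteq> {0<..}"

end

theory Submission
  imports Defs
begin

text \<open>
  Write \<open>kappa y\<close> as the sum of \<open>g(d)\<close> over the squarefree \<open>d\<close> dividing \<open>y\<close>, with \<open>g\<close> multiplicative and
  \<open>g(p) = O(p\<^sup>-\<^sup>2)\<close>. Averaging over \<open>u\<close> turns the sum over \<open>y\<close> into \<open>\<Sum> kappa y * W (y / sqrt \<Xi>)\<close>, where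
  \<open>W\<close> is continuously differentiable on the closed half-line and has bounded support, since the
  singularity of the inverse square root is smoothed out. For each \<open>d\<close> the trapezoidal rule gives
  \<open>\<Sum> W (m h) = (1 / h) * \<integral> W - W 0 / 2 + o(1)\<close> with \<open>h = d / sqrt \<Xi>\<close>, the error being bounded uniformly in
  \<open>h\<close>. Summing over \<open>d\<close> by dominated convergence, the main terms assemble to \<open>sqrt \<Xi>\<close> times
  \<open>\<Prod> (1 + g(p) / p)\<close> and are cancelled by the subtracted term, while the boundary terms give
  \<open>- (W 0 / 2) * \<Prod> (1 + g(p))\<close>. Both products are matched against the constants prime by prime.
\<close>

subsection \<open>Products over the primes\<close>

text \<open>The value -1/2 arises as follows. The kernel \<open>1 / sqrt (4 - x^2)\<close> is 1/2 at
  0, so \<open>W 0\<close> is half the normalising integral. The Euler products give c_bar * 11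
  zeta(2) / (4 A) * \<Prod> (1 + g(p)) = 2, so the boundary terms add up to exactly - W(0). The same
  kernel has integral pi / 2 over [0, 2), and c_bar * zeta(2) * \<Prod> (1 + g(p) / p) = 2/3. The
  main term therefore has the coefficient 11 pi / (12 A) of the subtracted term, and the two cancel
  exactly for every \<Xi> > 0, not just to leading order. The obstacle in the sum over d is that the
  step d / sqrt \<Xi> is small only for d well below sqrt \<Xi>. The remaining d are controlled by
  the error bound uniform in the step together with the convergence of \<Sum> g(d). The other
  obstacle is smoothness of W on the closed half-line. The trigonometric substitution that removes
  the singularity has t in its denominators, so it serves only t > 0; near t = 0 the singularity
  lies beyond the support of the weight and the original integral is differentiated instead.\<close>

definition primes_upto :: "nat \<Rightarrow> nat set" where
  "primes_upto n = {p. prime p \<and> p \<le> n}"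

lemma finite_primes_upto [simp]: "finite (primes_upto n)"
  unfolding primes_upto_def by (rule finite_subset[of _ "{..n}"]) auto

lemma summable_inverse_squares: "summable (\<lambda>n. c / real n ^ 2)"
  using summable_mult[OF inverse_power_summable[of 2, where 'a=real], of c]
  by (simp add: divide_inverse)

text \<open>An infinite product is a definite description, so constants such as \<open>c_bar\<close>
  and \<open>A_const\<close> can be computed with only after convergence is shown. Local factors
  within O(p^-2) of 1 give absolute convergence, and then the limit can vanish only if some factor
  does.\<close>

lemma prime_product_LIMSEQ:
  fixes f :: "nat \<Rightarrow> real"
  assumes bound: "\<And>p. prime p \<Longrightarrow> \<bar>f p - 1\<bar> \<le> c / real p ^ 2"
  shows "(\<lambda>n. \<Prod>p\<in>primes_upto n. f p) \<longlonglongrightarrow> (\<Prod>p. if prime p then f p else 1)"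
    and "(\<And>p. prime p \<Longrightarrow> f p \<noteq> 0) \<Longrightarrow> (\<Prod>p. if prime p then f p else 1) \<noteq> 0"
proof -
  let ?f = "\<lambda>p. if prime p then f p else 1"
  \<comment> \<open>The sign of \<open>c\<close> is read off at p = 2. The comparison below uses it
    at the indices that are not prime, where the term is 0.\<close>
  have "0 \<le> c / 4" using order.trans[OF abs_ge_zero bound[OF two_is_prime_nat]] by simp
  hence c: "c \<ge> 0" by simp
  have "summable (\<lambda>n. norm (?f n - 1))"
    by (rule summable_comparison_test'[OF summable_inverse_squares[of c], of 0])
       (use bound c in \<open>simp add: real_norm_def\<close>)
  hence "abs_convergent_prod ?f" by (simp add: abs_convergent_prod_conv_summable)
  hence conv: "convergent_prod ?f" by (rule abs_convergent_prod_imp_convergent_prod)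
  have "(\<Prod>i\<le>n. ?f i) = (\<Prod>p\<in>primes_upto n. f p)" for n
    by (subst prod.inter_filter[symmetric]) (auto simp: primes_upto_def intro!: prod.cong)
  with convergent_prod_LIMSEQ[OF conv]
  show "(\<lambda>n. \<Prod>p\<in>primes_upto n. f p) \<longlonglongrightarrow> prodinf ?f" by simp
  show "prodinf ?f \<noteq> 0" if "\<And>p. prime p \<Longrightarrow> f p \<noteq> 0"
    using prodinf_nonzero[OF conv] that by auto
qed

subsection \<open>The Euler product of \<open>\<zeta>(2)\<close>\<close>

text \<open>What is left of zeta(2) after sieving out the primes in \<open>S\<close>. The sum is
  unordered so that its index set can be split and rescaled freely.\<close>

definition coprime_inverse_squares :: "nat set \<Rightarrow> real" where
  "coprime_inverse_squares S = (\<Sum>\<^sub>\<infinity>n | n > 0 \<and> (\<forall>p\<in>S. \<not> p dvd n). 1 / real n ^ 2)"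

lemma inverse_squares_summable_on: "(\<lambda>n::nat. 1 / real n ^ 2) summable_on A"
  by (rule summable_on_subset_banach[of _ UNIV])
     (auto intro!: summable_nonneg_imp_summable_on summable_inverse_squares)

text \<open>A survivor of the sieve by \<open>S\<close> is either not divisible by \<open>p\<close>
  or \<open>p\<close> times another survivor, and scaling the index by \<open>p\<close> multiplies
  the sum by \<open>1 / p^2\<close>.\<close>

lemma coprime_inverse_squares_insert:
  assumes S: "\<And>q. q \<in> S \<Longrightarrow> prime q" and p: "prime p" "p \<notin> S"
  shows "coprime_inverse_squares (insert p S) = (1 - 1 / real p ^ 2) * coprime_inverse_squares S"
proof -
  let ?A = "{n. n > 0 \<and> (\<forall>q\<in>S. \<not> q dvd n)}" and ?B = "{n. n > 0 \<and> (\<forall>q\<in>insert p S. \<not> q dvd n)}"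
  let ?f = "\<lambda>n::nat. 1 / real n ^ 2"
  have p0: "p > 0" using p prime_gt_0_nat by blast
  have nd: "\<not> q dvd p" if "q \<in> S" for q
    using S[OF that] p that primes_dvd_imp_eq by blast
  have "?A = ?B \<union> (*) p ` ?A"
  proof (intro set_eqI iffI)
    fix n assume n: "n \<in> ?A"
    show "n \<in> ?B \<union> (*) p ` ?A"
    proof (cases "p dvd n")
      case True
      then obtain m where "n = p * m" by blast
      moreover from this n have "m \<in> ?A" by auto
      ultimately show ?thesis by blast
    qed (use n in auto)
  next
    fix n assume "n \<in> ?B \<union> (*) p ` ?A"
    thus "n \<in> ?A" using p0 nd S by (auto simp: prime_dvd_mult_iff)
  qed
  moreover have "infsum ?f (?B \<union> (*) p ` ?A) = infsum ?f ?B + infsum ?f ((*) p ` ?A)"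
    by (intro infsum_Un_disjoint inverse_squares_summable_on) auto
  moreover have "infsum ?f ((*) p ` ?A) = (\<Sum>\<^sub>\<infinity>n\<in>?A. 1 / real p ^ 2 * ?f n)"
    using p0 by (subst infsum_reindex) (auto simp: inj_on_def o_def power_mult_distrib)
  moreover have "\<dots> = 1 / real p ^ 2 * infsum ?f ?A"
    by (intro infsum_cmult_right inverse_squares_summable_on)
  ultimately have "infsum ?f ?A = infsum ?f ?B + 1 / real p ^ 2 * infsum ?f ?A"
    by metis
  thus ?thesis unfolding coprime_inverse_squares_def by (simp add: algebra_simps)
qed

lemma zeta_real_2_sums: "(\<lambda>n. 1 / real (Suc n) ^ 2) sums zeta_real 2"
proof -
  have "summable (\<lambda>n. 1 / real (Suc n) ^ 2)"
    using summable_inverse_squares[of 1] by (subst (asm) summable_Suc_iff[symmetric]) simp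
  hence "(\<lambda>n. 1 / real (Suc n) ^ 2) sums (\<Sum>n. 1 / real (Suc n) ^ 2)" by (rule summable_sums)
  thus ?thesis by (simp add: zeta_real_def powr_numeral del: of_nat_Suc)
qed

lemma coprime_inverse_squares_empty: "coprime_inverse_squares {} = zeta_real 2"
proof -
  have "((\<lambda>n. 1 / real (Suc n) ^ 2) has_sum zeta_real 2) UNIV"
    by (rule sums_nonneg_imp_has_sum[OF zeta_real_2_sums]) auto
  moreover have "(\<lambda>n. 1 / real n ^ 2) \<circ> Suc = (\<lambda>n. 1 / real (Suc n) ^ 2)"
    by (simp only: o_def)
  ultimately have "((\<lambda>n. 1 / real n ^ 2) has_sum zeta_real 2) (range Suc)"
    by (simp add: has_sum_reindex del: of_nat_Suc)
  moreover have "range Suc = {n. n > 0}"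
    using greaterThan_0 by (simp add: greaterThan_def)
  ultimately show ?thesis unfolding coprime_inverse_squares_def by (simp add: infsumI)
qed

lemma coprime_inverse_squares_prod:
  assumes "finite S" "\<And>q. q \<in> S \<Longrightarrow> prime q"
  shows "coprime_inverse_squares S = (\<Prod>p\<in>S. 1 - 1 / real p ^ 2) * zeta_real 2"
  using assms
proof (induction S rule: finite_induct)
  case empty
  thus ?case by (simp add: coprime_inverse_squares_empty)
next
  case (insert p S)
  thus ?case by (subst coprime_inverse_squares_insert) auto
qed

text \<open>Apart from 1, a number with no prime factor up to \<open>n\<close> has one above
  \<open>n\<close> and so exceeds \<open>n\<close>. The sum thus lies between 1 and 1 plus a tail of
  zeta(2).\<close>

lemma coprime_inverse_squares_tendsto_1:
  "(\<lambda>n. coprime_inverse_squares (primes_upto n)) \<longlonglongrightarrow> 1"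
proof (rule tendsto_sandwich)
  let ?f = "\<lambda>n::nat. 1 / real n ^ 2"
  let ?A = "\<lambda>n. {k. k > 0 \<and> (\<forall>p\<in>primes_upto n. \<not> p dvd k)}"
  have one: "1 \<in> ?A n" for n by (auto simp: primes_upto_def)
  have "infsum ?f {1} \<le> infsum ?f (?A n)" for n
    by (intro infsum_mono2 inverse_squares_summable_on) (use one in auto)
  thus "\<forall>\<^sub>F n in sequentially. 1 \<le> coprime_inverse_squares (primes_upto n)"
    by (simp add: coprime_inverse_squares_def)
  have sub: "?A n \<subseteq> {1} \<union> {n<..}" for n
  proof
    fix k assume k: "k \<in> ?A n"
    show "k \<in> {1} \<union> {n<..}"
    proof (cases "k = 1")
      case False
      then obtain p where p: "prime p" "p dvd k" using prime_factor_nat by blast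
      with k have "p > n" by (auto simp: primes_upto_def)
      moreover have "p \<le> k" using p k by (auto intro: dvd_imp_le)
      ultimately show ?thesis by auto
    qed auto
  qed
  have "coprime_inverse_squares (primes_upto n) \<le> 1 + (zeta_real 2 - (\<Sum>k<n. 1 / real (Suc k) ^ 2))"
    if n: "n \<ge> 1" for n
  proof -
    have "infsum ?f {0<..} = infsum ?f ({1..n} \<union> {n<..})"
      by (rule arg_cong2[where f = infsum]) (use n in auto)
    also have "\<dots> = infsum ?f {1..n} + infsum ?f {n<..}"
      by (intro infsum_Un_disjoint inverse_squares_summable_on) auto
    also have "infsum ?f {1..n} = (\<Sum>k<n. 1 / real (Suc k) ^ 2)"
      by (simp add: sum.atLeast1_atMost_eq)
    also have "infsum ?f {0<..} = zeta_real 2"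
      using coprime_inverse_squares_empty
      by (simp add: coprime_inverse_squares_def greaterThan_def)
    finally have "infsum ?f {n<..} = zeta_real 2 - (\<Sum>k<n. 1 / real (Suc k) ^ 2)" by simp
    moreover have "infsum ?f (?A n) \<le> infsum ?f ({1} \<union> {n<..})"
      by (intro infsum_mono2 inverse_squares_summable_on sub) auto
    moreover have "infsum ?f ({1} \<union> {n<..}) = infsum ?f {1} + infsum ?f {n<..}"
      by (intro infsum_Un_disjoint inverse_squares_summable_on) (use n in auto)
    ultimately show ?thesis by (simp add: coprime_inverse_squares_def)
  qed
  thus "\<forall>\<^sub>F n in sequentially. coprime_inverse_squares (primes_upto n)
      \<le> 1 + (zeta_real 2 - (\<Sum>k<n. 1 / real (Suc k) ^ 2))"
    unfolding eventually_sequentially by blast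
  have "(\<lambda>n. 1 + (zeta_real 2 - (\<Sum>k<n. 1 / real (Suc k) ^ 2))) \<longlonglongrightarrow> 1 + (zeta_real 2 - zeta_real 2)"
    using zeta_real_2_sums unfolding sums_def by (intro tendsto_intros)
  thus "(\<lambda>n. 1 + (zeta_real 2 - (\<Sum>k<n. 1 / real (Suc k) ^ 2))) \<longlonglongrightarrow> 1" by simp
qed auto

lemma zeta_real_2_pos: "zeta_real 2 > 0"
  using sums_unique[OF zeta_real_2_sums] sums_summable[OF zeta_real_2_sums]
  by (auto intro!: suminf_pos simp del: of_nat_Suc)

lemma euler_product_zeta_2:
  "(\<lambda>n. \<Prod>p\<in>primes_upto n. 1 - 1 / real p ^ 2) \<longlonglongrightarrow> 1 / zeta_real 2"
proof -
  have "(\<lambda>n. coprime_inverse_squares (primes_upto n) / zeta_real 2) \<longlonglongrightarrow> 1 / zeta_real 2"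
    by (intro tendsto_divide coprime_inverse_squares_tendsto_1 tendsto_const)
       (use zeta_real_2_pos in auto)
  moreover have "coprime_inverse_squares (primes_upto n) / zeta_real 2
      = (\<Prod>p\<in>primes_upto n. 1 - 1 / real p ^ 2)" for n
    using zeta_real_2_pos
    by (subst coprime_inverse_squares_prod) (auto simp: primes_upto_def[symmetric], auto simp: primes_upto_def)
  ultimately show ?thesis by simp
qed

subsection \<open>The arithmetic weight and the constants\<close>

text \<open>The g of the overview at primes: the local factor of \<open>kappa\<close> minus 1. The
  prime 2 is exceptional; the formula for odd primes would give 4/7 there.\<close>

definition kappa_coeff :: "nat \<Rightarrow> real" where
  "kappa_coeff p = (if p = 2 then 1 else real p ^ 2 / (real p ^ 4 - 2 * real p ^ 2 - real p + 1))"

text \<open>For x >= 3, \<open>2 * x^2 + x\<close> is at most 7/3 of \<open>x^2\<close>, whereas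
  \<open>x^4 / 2\<close> is at least 9/2 of it. At x = 2 the inequality fails, 7 against 8.\<close>

lemma kappa_denom_ge:
  fixes x :: real assumes "x \<ge> 3"
  shows "x ^ 4 - 2 * x ^ 2 - x + 1 \<ge> x ^ 4 / 2"
proof -
  have x2: "x\<^sup>2 \<ge> 3 * x" using assms by (simp add: power2_eq_square mult_right_mono)
  have "x ^ 4 = x\<^sup>2 * x\<^sup>2" by algebra
  also have "\<dots> \<ge> 9 * x\<^sup>2" using x2 assms by (intro mult_right_mono) auto
  finally show ?thesis using x2 assms by linarith
qed

text \<open>The constant 4 is dictated by \<open>kappa_coeff 2 = 1\<close>; at odd primes the
  argument gives 2.\<close>

lemma kappa_coeff_bounds:
  assumes "prime p"
  shows "0 \<le> kappa_coeff p" "kappa_coeff p \<le> 4 / real p ^ 2"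
proof -
  have "0 \<le> kappa_coeff p \<and> kappa_coeff p \<le> 4 / real p ^ 2"
  proof (cases "p = 2")
    case False
    hence p: "real p \<ge> 3" using prime_ge_2_nat[OF assms] by simp
    let ?P = "real p ^ 4 - 2 * real p ^ 2 - real p + 1"
    have P: "?P \<ge> real p ^ 4 / 2" by (rule kappa_denom_ge[OF p])
    have pos: "real p ^ 4 / 2 > 0" using p by simp
    have "real p ^ 2 / ?P \<le> real p ^ 2 / (real p ^ 4 / 2)"
      using P pos by (intro divide_left_mono mult_pos_pos zero_le_power2) linarith+
    also have "\<dots> = 2 / real p ^ 2"
      using p by (simp add: power4_eq_xxxx power2_eq_square)
    also have "\<dots> \<le> 4 / real p ^ 2" by (simp add: divide_right_mono)
    finally have "real p ^ 2 / ?P \<le> 4 / real p ^ 2" .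
    moreover have "real p ^ 2 / ?P \<ge> 0" using P pos by (intro divide_nonneg_nonneg zero_le_power2) linarith
    ultimately show ?thesis using False by (simp add: kappa_coeff_def)
  qed (auto simp: kappa_coeff_def)
  thus "0 \<le> kappa_coeff p" "kappa_coeff p \<le> 4 / real p ^ 2" by auto
qed

lemma kappa_eq_prod:
  assumes "y > 0"
  shows "kappa y = (\<Prod>p | prime p \<and> p dvd y. 1 + kappa_coeff p)"
proof -
  let ?A = "{p. prime p \<and> p dvd y}" and ?B = "{q. prime q \<and> odd q \<and> q dvd y}"
  have fin: "finite ?A" using assms by simp
  have fin_B: "finite ?B" using assms by (auto intro: finite_subset[OF _ fin])
  have AB: "?A = ?B \<union> (if even y then {2} else {})"
    using primes_dvd_imp_eq[OF two_is_prime_nat] by auto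
  have "(\<Prod>p\<in>?A. 1 + kappa_coeff p)
      = (\<Prod>p\<in>?B. 1 + kappa_coeff p) * (\<Prod>p\<in>(if even y then {2} else {}). 1 + kappa_coeff p)"
    unfolding AB by (rule prod.union_disjoint) (use fin_B in auto)
  also have "(\<Prod>p\<in>?B. 1 + kappa_coeff p)
      = (\<Prod>q\<in>?B. 1 + real q ^ 2 / (real q ^ 4 - 2 * real q ^ 2 - real q + 1))"
    by (intro prod.cong) (auto simp: kappa_coeff_def)
  also have "(\<Prod>p\<in>(if even y then {2} else {}). 1 + kappa_coeff p) = 2 ^ (if even y then 1 else 0)"
    by (auto simp: kappa_coeff_def)
  finally show ?thesis by (simp add: kappa_def)
qed

text \<open>Expansion of the product over the primes dividing \<open>y\<close>. A squarefree divisor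
  is encoded as its set of prime factors, which makes g(d) a plain product. All sets are drawn from
  the primes up to one \<open>N\<close>, independent of \<open>y\<close>, so that the sums over
  \<open>y\<close> and \<open>T\<close> can be exchanged later.\<close>

lemma kappa_eq_sum:
  assumes "y > 0" "y \<le> N"
  shows "kappa y = (\<Sum>T | T \<subseteq> primes_upto N \<and> \<Prod>T dvd y. \<Prod>p\<in>T. kappa_coeff p)"
proof -
  let ?A = "{p. prime p \<and> p dvd y}"
  have fin: "finite ?A" using assms by simp
  have iff: "\<Prod>T dvd y \<longleftrightarrow> (\<forall>p\<in>T. p dvd y)" if "T \<subseteq> primes_upto N" for T
  proof -
    have "finite T" using that finite_primes_upto by (rule finite_subset)
    hence "(\<forall>p\<in>T. p dvd y) \<Longrightarrow> \<Prod>T dvd y" using that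
    proof (induction T rule: finite_induct)
      case (insert p T)
      have "coprime p (\<Prod>T)"
        using insert by (intro prod_coprime_right) (auto simp: primes_upto_def intro!: primes_coprime)
      thus ?case using insert by (auto intro: divides_mult)
    qed auto
    moreover have "\<Prod>T dvd y \<Longrightarrow> (\<forall>p\<in>T. p dvd y)"
      using \<open>finite T\<close> by (meson dvd_prodI dvd_trans)
    ultimately show ?thesis by blast
  qed
  have "kappa y = (\<Prod>p\<in>?A. kappa_coeff p + 1)" using assms(1) by (simp add: kappa_eq_prod add.commute)
  also have "\<dots> = (\<Sum>T\<in>Pow ?A. \<Prod>p\<in>T. kappa_coeff p)"
    by (subst prod_add[OF fin]) simp
  also have "Pow ?A = {T. T \<subseteq> primes_upto N \<and> \<Prod>T dvd y}"
  proof (intro set_eqI iffI)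
    fix T assume "T \<in> Pow ?A"
    moreover have "?A \<subseteq> primes_upto N"
      using assms by (auto simp: primes_upto_def dest!: dvd_imp_le)
    ultimately show "T \<in> {T. T \<subseteq> primes_upto N \<and> \<Prod>T dvd y}" using iff[of T] by blast
  next
    fix T assume "T \<in> {T. T \<subseteq> primes_upto N \<and> \<Prod>T dvd y}"
    thus "T \<in> Pow ?A" using iff[of T] by (auto simp: primes_upto_def)
  qed
  finally show ?thesis .
qed

text \<open>As a sum, this is \<Sum> g(d) / d over squarefree d, the mean value of
  \<open>kappa\<close>; \<open>kappa_total\<close> below is \<Sum> g(d).\<close>

definition kappa_mean :: real where
  "kappa_mean = (\<Prod>p. if prime p then 1 + kappa_coeff p / real p else 1)"

definition kappa_total :: real where
  "kappa_total = (\<Prod>p. if prime p then 1 + kappa_coeff p else 1)"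

lemma kappa_mean_LIMSEQ:
  "(\<lambda>n. \<Prod>p\<in>primes_upto n. 1 + kappa_coeff p / real p) \<longlonglongrightarrow> kappa_mean"
  unfolding kappa_mean_def
proof (rule prime_product_LIMSEQ(1)[where c = 4])
  fix p :: nat assume p: "prime p"
  have "kappa_coeff p / real p \<le> kappa_coeff p / 1"
    using kappa_coeff_bounds[OF p] prime_gt_0_nat[OF p] by (intro divide_left_mono) auto
  thus "\<bar>1 + kappa_coeff p / real p - 1\<bar> \<le> 4 / real p ^ 2"
    using kappa_coeff_bounds[OF p] by simp
qed

lemma kappa_total_LIMSEQ:
  "(\<lambda>n. \<Prod>p\<in>primes_upto n. 1 + kappa_coeff p) \<longlonglongrightarrow> kappa_total"
  unfolding kappa_total_def
proof (rule prime_product_LIMSEQ(1)[where c = 4])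
  fix p :: nat assume p: "prime p"
  show "\<bar>1 + kappa_coeff p - 1\<bar> \<le> 4 / real p ^ 2"
    using kappa_coeff_bounds[OF p] by simp
qed

definition c_factor :: "nat \<Rightarrow> real" where
  "c_factor l = (if l > 2 then 1 - 1 / real l ^ 2 - (1 / real l ^ 3) / (1 - 1 / real l ^ 2) else 1)"

definition A_factor :: "nat \<Rightarrow> real" where
  "A_factor q = 1 + real q / ((real q + 1) ^ 2 * (real q - 1))"

text \<open>The numerator is the denominator of \<open>kappa_coeff\<close> at odd primes, so
  multiplying by 1 + g(p) or 1 + g(p) / p clears it.\<close>

lemma c_factor_eq:
  assumes "l > 2"
  shows "c_factor l = (real l ^ 4 - 2 * real l ^ 2 - real l + 1) / (real l ^ 2 * (real l ^ 2 - 1))"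
proof -
  let ?x = "real l"
  have x: "?x > 2" using assms by simp
  have "?x ^ 2 > 2 ^ 2" using x by (intro power_strict_mono) auto
  hence nz: "?x ^ 2 - 1 \<noteq> 0" "?x \<noteq> 0" using x by auto
  have "1 - 1 / ?x ^ 2 = (?x ^ 2 - 1) / ?x ^ 2" using nz by (simp add: field_simps)
  hence "(1 / ?x ^ 3) / (1 - 1 / ?x ^ 2) = 1 / (?x * (?x ^ 2 - 1))"
    using nz by (simp add: power3_eq_cube power2_eq_square)
  hence "c_factor l = 1 - 1 / ?x ^ 2 - 1 / (?x * (?x ^ 2 - 1))"
    using assms by (simp add: c_factor_def)
  also have "\<dots> = (?x ^ 4 - 2 * ?x ^ 2 - ?x + 1) / (?x ^ 2 * (?x ^ 2 - 1))"
  proof -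
    have "(?x ^ 2 * (?x ^ 2 - 1)) * (1 - 1 / ?x ^ 2 - 1 / (?x * (?x ^ 2 - 1)))
        = ?x ^ 2 * (?x ^ 2 - 1) - (?x ^ 2 - 1) - ?x"
    proof -
      have "?x ^ 2 * (?x ^ 2 - 1) * (1 / ?x ^ 2) = ?x ^ 2 - 1"
        using nz by simp
      moreover have "?x ^ 2 * (?x ^ 2 - 1) * (1 / (?x * (?x ^ 2 - 1))) = ?x"
        using nz by (simp add: power2_eq_square)
      ultimately show ?thesis by (simp only: right_diff_distrib mult_1_right)
    qed
    also have "\<dots> = ?x ^ 4 - 2 * ?x ^ 2 - ?x + 1" by algebra
    finally show ?thesis using nz by (simp add: eq_divide_eq mult.commute)
  qed
  finally show ?thesis .
qed

lemma c_factor_LIMSEQ: "(\<lambda>n. \<Prod>p\<in>primes_upto n. c_factor p) \<longlonglongrightarrow> 3 * c_bar"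
proof -
  have "(\<lambda>n. \<Prod>p\<in>primes_upto n. c_factor p) \<longlonglongrightarrow> (\<Prod>p. if prime p then c_factor p else 1)"
  \<comment> \<open>3 = 1 + 2: one from \<open>1 / p^2\<close>, two from the last term, which is at
    most \<open>2 / p^3\<close> because \<open>1 - 1 / p^2\<close> is at least 1/2.\<close>
  proof (rule prime_product_LIMSEQ(1)[where c = 3])
    fix p :: nat assume p: "prime p"
    show "\<bar>c_factor p - 1\<bar> \<le> 3 / real p ^ 2"
    proof (cases "p > 2")
      case True
      let ?x = "real p"
      have x: "?x > 2" using True by simp
      have x2: "?x ^ 2 > 2 ^ 2" using x by (intro power_strict_mono) auto
      have inv: "1 / ?x ^ 2 \<le> 1 / 2" using x2 x by (intro divide_left_mono) auto
      have "(1 / ?x ^ 3) / (1 - 1 / ?x ^ 2) \<le> (1 / ?x ^ 3) / (1 / 2)"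
        using inv x by (intro divide_left_mono mult_pos_pos) auto
      also have "\<dots> = 2 / ?x ^ 3" by simp
      also have "\<dots> \<le> 2 / ?x ^ 2"
        using x by (intro divide_left_mono power_increasing mult_pos_pos) auto
      finally have "(1 / ?x ^ 3) / (1 - 1 / ?x ^ 2) \<le> 2 / ?x ^ 2" .
      moreover have "(1 / ?x ^ 3) / (1 - 1 / ?x ^ 2) \<ge> 0"
        using inv x by (intro divide_nonneg_nonneg) auto
      moreover have "1 / ?x ^ 2 \<ge> 0" "1 / ?x ^ 2 + 2 / ?x ^ 2 = 3 / ?x ^ 2"
        by (auto simp: add_divide_distrib[symmetric])
      ultimately show ?thesis using True unfolding c_factor_def by (simp only: if_True abs_le_iff) linarith
    qed (auto simp: c_factor_def)
  qed
  moreover have "(if prime p then c_factor p else 1) = (if prime p \<and> p > 2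
     then 1 - 1 / real p ^ 2 - (1 / real p ^ 3) / (1 - 1 / real p ^ 2) else 1)" for p
    by (simp add: c_factor_def)
  ultimately show ?thesis by (simp add: c_bar_def)
qed

lemma A_factor_LIMSEQ: "(\<lambda>n. \<Prod>p\<in>primes_upto n. A_factor p) \<longlonglongrightarrow> A_const"
  and A_const_nonzero: "A_const \<noteq> 0"
proof -
  have eq: "A_const = (\<Prod>p. if prime p then A_factor p else 1)"
    unfolding A_const_def A_factor_def ..
  have bound: "\<bar>A_factor p - 1\<bar> \<le> 2 / real p ^ 2" and pos: "A_factor p > 0" if "prime p" for p
  proof -
    let ?x = "real p"
    have x: "?x \<ge> 2" using prime_ge_2_nat[OF that] by simp
    have "?x * (?x + 1) \<le> (?x + 1) ^ 2" by (simp add: power2_eq_square algebra_simps)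
    moreover have "?x / 2 \<le> ?x - 1" using x by simp
    ultimately have "?x * (?x + 1) * (?x / 2) \<le> (?x + 1) ^ 2 * (?x - 1)"
      using x by (intro mult_mono) auto
    moreover have "?x * ?x * (?x / 2) \<le> ?x * (?x + 1) * (?x / 2)"
      using x by (intro mult_right_mono mult_left_mono) auto
    ultimately have le: "?x * ?x * (?x / 2) \<le> (?x + 1) ^ 2 * (?x - 1)" by linarith
    have "?x / ((?x + 1) ^ 2 * (?x - 1)) \<le> ?x / (?x * ?x * (?x / 2))"
      using le x by (intro divide_left_mono mult_pos_pos) auto
    also have "\<dots> = 2 / ?x ^ 2" using x by (simp add: power2_eq_square)
    finally have "?x / ((?x + 1) ^ 2 * (?x - 1)) \<le> 2 / ?x ^ 2" .
    moreover have "?x / ((?x + 1) ^ 2 * (?x - 1)) \<ge> 0" using x by simp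
    ultimately show "\<bar>A_factor p - 1\<bar> \<le> 2 / real p ^ 2" "A_factor p > 0"
      unfolding A_factor_def by linarith+
  qed
  show "(\<lambda>n. \<Prod>p\<in>primes_upto n. A_factor p) \<longlonglongrightarrow> A_const"
    unfolding eq by (rule prime_product_LIMSEQ(1)[OF bound])
  have "A_factor p \<noteq> 0" if "prime p" for p using pos[OF that] by simp
  thus "A_const \<noteq> 0" unfolding eq by (intro prime_product_LIMSEQ(2)[OF bound])
qed

text \<open>With P the common polynomial, P + p = \<open>(p^2 - 1)^2\<close>, which leaves precisely
  the local factor of 1 / zeta(2). At p = 2 the left side is 3/2 = 3/4 * 2, whence the correction
  2.\<close>

lemma c_factor_mult_mean:
  assumes "prime p"
  shows "c_factor p * (1 + kappa_coeff p / real p)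
       = (1 - 1 / real p ^ 2) * (if p = 2 then 2 else 1)"
proof (cases "p = 2")
  case False
  hence p: "p > 2" using prime_ge_2_nat[OF assms] by simp
  let ?x = "real p" let ?P = "?x ^ 4 - 2 * ?x ^ 2 - ?x + 1"
  have x: "?x \<ge> 3" using p by simp
  have "?x ^ 2 \<ge> 3 ^ 2" using x by (intro power_mono) auto
  moreover have "?P > 0" using kappa_denom_ge[OF x] x by (smt (verit) zero_less_power half_gt_zero)
  ultimately have nz: "?P \<noteq> 0" "?x ^ 2 - 1 \<noteq> 0" "?x \<noteq> 0" using x by auto
  have "1 + kappa_coeff p / ?x = (?P + ?x) / ?P"
  proof -
    have "1 + kappa_coeff p / ?x = ?P / ?P + ?x / ?P"
      using nz False by (simp add: kappa_coeff_def power2_eq_square)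
    thus ?thesis by (simp only: add_divide_distrib)
  qed
  hence "c_factor p * (1 + kappa_coeff p / ?x) = (?P + ?x) / (?x ^ 2 * (?x ^ 2 - 1))"
    using nz by (simp add: c_factor_eq[OF p])
  also have "?P + ?x = (?x ^ 2 - 1) * (?x ^ 2 - 1)" by algebra
  also have "\<dots> / (?x ^ 2 * (?x ^ 2 - 1)) = 1 - 1 / ?x ^ 2"
    using nz by (simp add: diff_divide_distrib)
  finally show ?thesis using False by simp
qed (simp add: c_factor_def kappa_coeff_def)

text \<open>P + p^2 factors as (p - 1) (p^3 + p^2 - 1), and p^3 + p^2 - 1 is also the numerator of
  \<open>A_factor p\<close>. At p = 2 the left side is 2 and \<open>A_factor 2\<close> is 11/9, so
  the correction is 2 / (11/9 * 3/4) = 24/11.\<close>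

lemma c_factor_mult_total:
  assumes "prime p"
  shows "c_factor p * (1 + kappa_coeff p)
       = A_factor p * (1 - 1 / real p ^ 2) * (if p = 2 then 24 / 11 else 1)"
proof (cases "p = 2")
  case False
  hence p: "p > 2" using prime_ge_2_nat[OF assms] by simp
  let ?x = "real p" let ?P = "?x ^ 4 - 2 * ?x ^ 2 - ?x + 1"
  have x: "?x \<ge> 3" using p by simp
  have "?x ^ 2 \<ge> 3 ^ 2" using x by (intro power_mono) auto
  moreover have "?P > 0" using kappa_denom_ge[OF x] x by (smt (verit) zero_less_power half_gt_zero)
  ultimately have nz: "?P \<noteq> 0" "?x ^ 2 - 1 \<noteq> 0" "?x \<noteq> 0" "?x + 1 \<noteq> 0" "?x - 1 \<noteq> 0" using x by auto
  have "1 + kappa_coeff p = (?P + ?x ^ 2) / ?P"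
  proof -
    have "1 + kappa_coeff p = ?P / ?P + ?x ^ 2 / ?P"
      using nz False by (simp add: kappa_coeff_def)
    thus ?thesis by (simp only: add_divide_distrib)
  qed
  hence "c_factor p * (1 + kappa_coeff p) = (?P + ?x ^ 2) / (?x ^ 2 * (?x ^ 2 - 1))"
    using nz by (simp add: c_factor_eq[OF p])
  also have "?P + ?x ^ 2 = (?x - 1) * (?x ^ 3 + ?x ^ 2 - 1)" by algebra
  also have "?x ^ 2 * (?x ^ 2 - 1) = (?x - 1) * (?x ^ 2 * (?x + 1))" by algebra
  also have "(?x - 1) * (?x ^ 3 + ?x ^ 2 - 1) / \<dots> = (?x ^ 3 + ?x ^ 2 - 1) / (?x ^ 2 * (?x + 1))"
    using nz by simp
  finally have lhs: "c_factor p * (1 + kappa_coeff p) = (?x ^ 3 + ?x ^ 2 - 1) / (?x ^ 2 * (?x + 1))" .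
  have "A_factor p = ((?x + 1) ^ 2 * (?x - 1) + ?x) / ((?x + 1) ^ 2 * (?x - 1))"
    using nz by (simp add: A_factor_def add_divide_distrib)
  also have "(?x + 1) ^ 2 * (?x - 1) + ?x = ?x ^ 3 + ?x ^ 2 - 1" by algebra
  finally have "A_factor p = (?x ^ 3 + ?x ^ 2 - 1) / ((?x + 1) ^ 2 * (?x - 1))" .
  moreover have "1 - 1 / ?x ^ 2 = (?x + 1) * (?x - 1) / ?x ^ 2"
    using nz by (simp add: field_simps power2_eq_square)
  ultimately have "A_factor p * (1 - 1 / ?x ^ 2)
      = ((?x ^ 3 + ?x ^ 2 - 1) * ((?x + 1) * (?x - 1))) / (((?x + 1) ^ 2 * (?x - 1)) * ?x ^ 2)"
    by simp
  also have "\<dots> = ((?x ^ 3 + ?x ^ 2 - 1) * ((?x + 1) * (?x - 1))) / ((?x ^ 2 * (?x + 1)) * ((?x + 1) * (?x - 1)))"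
    by (rule arg_cong2[where f = "(/)"]) algebra+
  also have "\<dots> = (?x ^ 3 + ?x ^ 2 - 1) / (?x ^ 2 * (?x + 1))"
    using nz by (intro nonzero_mult_divide_mult_cancel_right) auto
  finally show ?thesis using lhs False by simp
qed (simp add: c_factor_def kappa_coeff_def A_factor_def)

lemma prod_primes_upto_if_2:
  assumes "n \<ge> 2"
  shows "(\<Prod>p\<in>primes_upto n. if p = 2 then c else 1) = (c::real)"
  using assms by (subst prod.delta) (auto simp: primes_upto_def)

lemma c_bar_kappa_mean: "c_bar * kappa_mean * zeta_real 2 = 2 / 3"
proof -
  have 1: "(\<lambda>n. (\<Prod>p\<in>primes_upto n. c_factor p) * (\<Prod>p\<in>primes_upto n. 1 + kappa_coeff p / real p))
      \<longlonglongrightarrow> 3 * c_bar * kappa_mean"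
    by (intro tendsto_mult c_factor_LIMSEQ kappa_mean_LIMSEQ)
  have 2: "(\<lambda>n. (\<Prod>p\<in>primes_upto n. 1 - 1 / real p ^ 2) * 2) \<longlonglongrightarrow> 1 / zeta_real 2 * 2"
    by (intro tendsto_mult euler_product_zeta_2 tendsto_const)
  \<comment> \<open>The truncated products agree only from n = 2 on, when the exceptional prime is
    included.\<close>
  have 3: "\<forall>\<^sub>F n in sequentially. (\<Prod>p\<in>primes_upto n. c_factor p) * (\<Prod>p\<in>primes_upto n. 1 + kappa_coeff p / real p)
      = (\<Prod>p\<in>primes_upto n. 1 - 1 / real p ^ 2) * 2"
    using eventually_ge_at_top[of 2]
  proof eventually_elim
    case (elim n)
    have "(\<Prod>p\<in>primes_upto n. c_factor p) * (\<Prod>p\<in>primes_upto n. 1 + kappa_coeff p / real p)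
       = (\<Prod>p\<in>primes_upto n. (1 - 1 / real p ^ 2) * (if p = 2 then 2 else 1))"
      unfolding prod.distrib[symmetric]
      by (intro prod.cong c_factor_mult_mean) (auto simp: primes_upto_def)
    thus ?case by (simp only: prod.distrib prod_primes_upto_if_2[OF elim])
  qed
  have "3 * c_bar * kappa_mean = 1 / zeta_real 2 * 2"
    by (rule LIMSEQ_unique[OF Lim_transform_eventually[OF 1 3] 2])
  thus ?thesis using zeta_real_2_pos by (simp add: field_simps)
qed

lemma c_bar_kappa_total: "c_bar * kappa_total * zeta_real 2 = 8 / 11 * A_const"
proof -
  have 1: "(\<lambda>n. (\<Prod>p\<in>primes_upto n. c_factor p) * (\<Prod>p\<in>primes_upto n. 1 + kappa_coeff p))
      \<longlonglongrightarrow> 3 * c_bar * kappa_total"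
    by (intro tendsto_mult c_factor_LIMSEQ kappa_total_LIMSEQ)
  have 2: "(\<lambda>n. (\<Prod>p\<in>primes_upto n. A_factor p) * (\<Prod>p\<in>primes_upto n. 1 - 1 / real p ^ 2) * (24 / 11))
      \<longlonglongrightarrow> A_const * (1 / zeta_real 2) * (24 / 11)"
    by (intro tendsto_mult euler_product_zeta_2 A_factor_LIMSEQ tendsto_const)
  have 3: "\<forall>\<^sub>F n in sequentially. (\<Prod>p\<in>primes_upto n. c_factor p) * (\<Prod>p\<in>primes_upto n. 1 + kappa_coeff p)
      = (\<Prod>p\<in>primes_upto n. A_factor p) * (\<Prod>p\<in>primes_upto n. 1 - 1 / real p ^ 2) * (24 / 11)"
    using eventually_ge_at_top[of 2]
  proof eventually_elim
    case (elim n)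
    have "(\<Prod>p\<in>primes_upto n. c_factor p) * (\<Prod>p\<in>primes_upto n. 1 + kappa_coeff p)
       = (\<Prod>p\<in>primes_upto n. A_factor p * (1 - 1 / real p ^ 2) * (if p = 2 then 24 / 11 else 1))"
      unfolding prod.distrib[symmetric]
      by (intro prod.cong c_factor_mult_total) (auto simp: primes_upto_def)
    thus ?case by (simp only: prod.distrib prod_primes_upto_if_2[OF elim])
  qed
  have "3 * c_bar * kappa_total = A_const * (1 / zeta_real 2) * (24 / 11)"
    by (rule LIMSEQ_unique[OF Lim_transform_eventually[OF 1 3] 2])
  thus ?thesis using zeta_real_2_pos by (simp add: field_simps)
qed

subsection \<open>The trapezoidal rule for compactly supported functions\<close>

text \<open>Let the right end \<open>y\<close> vary. The error \<open>F y\<close> vanishes at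
  \<open>y = a\<close>, and by the mean value theorem its derivative is (y - a) / 2 times a
  difference of two values of \<open>f'\<close>. So only the oscillation of \<open>f'\<close>
  enters, which suits a \<open>W\<close> known merely to be continuously differentiable.\<close>

lemma trapezoid_error:
  fixes f f' :: "real \<Rightarrow> real"
  assumes h: "h \<ge> 0"
    and deriv: "\<And>x. x \<in> {a..a+h} \<Longrightarrow> (f has_real_derivative f' x) (at x within {a..a+h})"
    and mod: "\<And>x y. x \<in> {a..a+h} \<Longrightarrow> y \<in> {a..a+h} \<Longrightarrow> \<bar>f' x - f' y\<bar> \<le> e"
  shows "\<bar>integral {a..a+h} f - h / 2 * (f a + f (a + h))\<bar> \<le> h ^ 2 * e / 2"
proof -
  let ?I = "{a..a+h}"
  have cont: "continuous_on ?I f"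
    using deriv by (rule DERIV_continuous_on)
  have e: "e \<ge> 0" using mod[of a a] h by auto
  define F where "F y = integral {a..y} f - (y - a) / 2 * (f a + f y)" for y
  define F' where "F' y = (f y - f a) / 2 - (y - a) / 2 * f' y" for y
  have F: "(F has_real_derivative F' y) (at y within ?I)" if y: "y \<in> ?I" for y
  proof -
    have "((\<lambda>y. integral {a..y} f) has_real_derivative f y) (at y within ?I)"
      by (rule integral_has_real_derivative[OF cont y])
    thus ?thesis unfolding F_def[abs_def] F'_def
      by (auto intro!: derivative_eq_intros deriv[OF y] simp: field_simps)
  qed
  have bound: "\<bar>F' y\<bar> \<le> h * e / 2" if y: "y \<in> ?I" for y
  proof -
    have "\<exists>z\<in>{a..y}. f y - f a = f' z * (y - a)"
    proof (cases "a = y")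
      case False
      hence "a < y" using y by simp
      obtain x where "a < x" "x < y" "f y - f a = f' x * (y - a)"
      proof (rule mvt[OF \<open>a < y\<close>])
        show "continuous_on {a..y} f" using cont by (rule continuous_on_subset) (use y in auto)
        fix x assume x: "a < x" "x < y"
        have "(f has_real_derivative f' x) (at x within {a<..<y})"
          by (rule DERIV_subset[OF deriv]) (use x y in auto)
        thus "(f has_derivative (*) (f' x)) (at x)"
          using x by (simp add: has_field_derivative_def at_within_open[of x "{a<..<y}"])
      qed (rule that)
      thus ?thesis by (intro bexI[of _ x]) auto
    qed (auto intro!: bexI[of _ a])
    then obtain z where z: "z \<in> {a..y}" "f y - f a = f' z * (y - a)" by blast
    have "F' y = (y - a) / 2 * (f' z - f' y)"
      unfolding F'_def z(2) by (simp add: field_simps)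
    hence "\<bar>F' y\<bar> = \<bar>(y - a) / 2\<bar> * \<bar>f' z - f' y\<bar>" by (simp only: abs_mult)
    also have "\<bar>(y - a) / 2\<bar> = (y - a) / 2" using y by simp
    also have "(y - a) / 2 * \<bar>f' z - f' y\<bar> \<le> h / 2 * e"
      using y z(1) h by (intro mult_mono mod) auto
    finally show ?thesis by simp
  qed
  have "\<bar>F (a + h) - F a\<bar> \<le> (h * e / 2) * \<bar>(a + h) - a\<bar>"
    using field_differentiable_bound[of ?I F F' "h * e / 2" "a + h" a] F bound h by simp
  thus ?thesis using h by (simp add: F_def power2_eq_square algebra_simps)
qed

text \<open>At 0 only the derivative from the right is required: the sums start at this end, and it
  is the one that produces the boundary term.\<close>

locale compact_C1 =
  fixes W W' :: "real \<Rightarrow> real" and B :: real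
  assumes B_pos: "B > 0"
    and W_deriv: "\<And>t. t \<ge> 0 \<Longrightarrow> (W has_real_derivative W' t) (at t within {0..})"
    and W'_cont: "continuous_on {0..} W'"
    and W_zero: "\<And>t. t \<ge> B \<Longrightarrow> W t = 0"
begin

definition W_int :: real where "W_int = integral {0..B} W"

text \<open>The bound \<open>n\<close> just makes the sum finite: all \<open>n\<close> with
  \<open>n * h >= B\<close> give the same value. For small \<open>h\<close> that value approaches
  \<open>- W 0 / 2\<close>.\<close>

definition riemann_error :: "nat \<Rightarrow> real \<Rightarrow> real" where
  "riemann_error n h = (\<Sum>m=1..n. W (real m * h)) - W_int / h"

lemma W_cont: "continuous_on {0..} W"
  using W_deriv by (intro DERIV_continuous_on) auto

lemma riemann_error_cong:
  assumes "h > 0" "real m * h \<ge> B" "m \<le> n"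
  shows "riemann_error n h = riemann_error m h"
proof -
  have "(\<Sum>k=1..n. W (real k * h)) = (\<Sum>k=1..m. W (real k * h))"
  proof (rule sum.mono_neutral_right)
    show "\<forall>k\<in>{1..n} - {1..m}. W (real k * h) = 0"
    proof
      fix k assume "k \<in> {1..n} - {1..m}"
      hence "real m * h \<le> real k * h" using assms by (intro mult_right_mono) auto
      thus "W (real k * h) = 0" using assms(2) by (intro W_zero) linarith
    qed
  qed (use assms in auto)
  thus ?thesis by (simp add: riemann_error_def)
qed

lemma W_int_eq:
  assumes "x \<ge> B"
  shows "integral {0..x} W = W_int"
proof -
  have "integral {0..B} W + integral {B..x} W = integral {0..x} W"
    using assms B_pos
    by (intro Henstock_Kurzweil_Integration.integral_combine integrable_continuous_real
        continuous_on_subset[OF W_cont]) auto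
  moreover have "integral {B..x} W = integral {B..x} (\<lambda>_. 0)"
    by (intro integral_cong W_zero) auto
  ultimately show ?thesis by (simp add: W_int_def)
qed

text \<open>Adding up the trapezoids gives inner nodes weight 1 and both ends weight 1/2; the far
  end contributes 0, so \<open>W 0 / 2\<close> remains. Each of \<open>m\<close> steps costs
  \<open>h^2 * e / 2\<close>; after division by \<open>h\<close> the total is
  \<open>m * h * e / 2\<close>.\<close>

lemma composite_trapezoid_error:
  assumes h: "h > 0"
    and mod: "\<And>x y. x \<ge> 0 \<Longrightarrow> y \<ge> 0 \<Longrightarrow> x \<le> B + h \<Longrightarrow> y \<le> B + h \<Longrightarrow> \<bar>x - y\<bar> \<le> h \<Longrightarrow>
      \<bar>W' x - W' y\<bar> \<le> e"
    and n: "real n * h \<ge> B"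
  shows "\<bar>riemann_error n h + W 0 / 2\<bar> \<le> (B + h) * e / 2"
proof -
  have e: "e \<ge> 0" using mod[of 0 0] B_pos h by auto
  \<comment> \<open>The least number of steps that reaches \<open>B\<close>. Since \<open>n\<close>
    may be far larger, the error is counted over \<open>m\<close> steps only, where
    \<open>m * h <= B + h\<close>.\<close>
  define m where "m = nat \<lceil>B / h\<rceil>"
  have mh: "real m * h \<ge> B"
    using h B_pos by (auto simp: m_def pos_divide_le_eq[symmetric] intro: order.trans[OF le_of_int_ceiling])
  have "real m \<le> B / h + 1"
    using h B_pos of_int_ceiling_le_add_one[of "B / h"] by (simp add: m_def)
  hence mh': "real m * h \<le> B + h" using h by (simp add: field_simps)
  have "m \<le> n"
    using n h B_pos unfolding m_def by (simp add: nat_le_iff ceiling_le_iff pos_divide_le_eq)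
  have trap: "\<bar>integral {0..real k * h} W - (\<Sum>j<k. h / 2 * (W (real j * h) + W (real (Suc j) * h)))\<bar>
      \<le> real k * (h ^ 2 * e / 2)" if "k \<le> m" for k
    using that
  proof (induction k)
    case (Suc k)
    let ?a = "real k * h"
    have a0: "?a \<ge> 0" using h by simp
    have aB: "?a + h \<le> B + h"
    proof -
      have "real (Suc k) * h \<le> real m * h" using Suc.prems h by (intro mult_right_mono) auto
      thus ?thesis using mh' by (simp add: algebra_simps)
    qed
    have f1: "integral {0..?a} W + integral {?a..?a + h} W = integral {0..?a + h} W"
      using h a0
      by (intro Henstock_Kurzweil_Integration.integral_combine integrable_continuous_real
        continuous_on_subset[OF W_cont]) auto
    have f2: "\<bar>integral {?a..?a+h} W - h / 2 * (W ?a + W (?a + h))\<bar> \<le> h ^ 2 * e / 2"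
    proof (rule trapezoid_error[where f' = W'])
      fix x assume x: "x \<in> {?a..?a+h}"
      show "(W has_real_derivative W' x) (at x within {?a..?a+h})"
        by (rule DERIV_subset[OF W_deriv]) (use x a0 in \<open>auto intro: order.trans[OF a0]\<close>)
      fix y assume y: "y \<in> {?a..?a+h}"
      show "\<bar>W' x - W' y\<bar> \<le> e"
        by (rule mod) (use x y a0 aB in \<open>auto intro: order.trans[OF a0]\<close>)
    qed (use h in auto)
    have f3: "real (Suc k) * h = ?a + h" by (simp add: algebra_simps)
    have f4: "real (Suc k) * (h ^ 2 * e / 2) = real k * (h ^ 2 * e / 2) + h ^ 2 * e / 2"
      by (simp add: algebra_simps)
    have f5: "(\<Sum>j<Suc k. h / 2 * (W (real j * h) + W (real (Suc j) * h)))
        = (\<Sum>j<k. h / 2 * (W (real j * h) + W (real (Suc j) * h))) + h / 2 * (W ?a + W (real (Suc k) * h))"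
      by (rule sum.lessThan_Suc)
    have f6: "\<bar>integral {0..?a} W - (\<Sum>j<k. h / 2 * (W (real j * h) + W (real (Suc j) * h)))\<bar>
      \<le> real k * (h ^ 2 * e / 2)" using Suc by simp
    have tri: "\<bar>(I + J) - (S + t)\<bar> \<le> a + b" if "\<bar>J - t\<bar> \<le> b" "\<bar>I - S\<bar> \<le> a" for I J S t a b :: real
      using that by linarith
    show ?case
      unfolding f5 f4 f3 f1[symmetric] by (rule tri[OF f2 f6])
  qed simp
  have "(\<Sum>j<m. h / 2 * (W (real j * h) + W (real (Suc j) * h)))
      = h * (\<Sum>k=1..m. W (real k * h)) + h / 2 * W 0 - h / 2 * W (real m * h)"
    by (induction m) (auto simp: algebra_simps)
  also have "W (real m * h) = 0" by (rule W_zero[OF mh])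
  finally have "\<bar>W_int - (h * (\<Sum>k=1..m. W (real k * h)) + h / 2 * W 0)\<bar> \<le> real m * (h ^ 2 * e / 2)"
    using trap[of m] W_int_eq[OF mh] by simp
  also have "W_int - (h * (\<Sum>k=1..m. W (real k * h)) + h / 2 * W 0) = - h * (riemann_error m h + W 0 / 2)"
    using h by (simp add: riemann_error_def field_simps)
  also have "\<bar>\<dots>\<bar> = h * \<bar>riemann_error m h + W 0 / 2\<bar>" using h by (simp add: abs_mult)
  also have "real m * (h ^ 2 * e / 2) = h * ((real m * h) * e / 2)" by (simp add: power2_eq_square)
  finally have "\<bar>riemann_error m h + W 0 / 2\<bar> \<le> (real m * h) * e / 2"
    using h by (simp only: mult_le_cancel_left_pos)
  also have "\<dots> \<le> (B + h) * e / 2" using mh' e by (intro divide_right_mono mult_right_mono) auto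
  finally show ?thesis using riemann_error_cong[OF h mh \<open>m \<le> n\<close>] by simp
qed

text \<open>\<open>W'\<close> is uniformly continuous on \<open>{0..B+1}\<close>, and
  \<open>h < 1\<close> keeps all nodes that matter inside that interval. The threshold does not
  depend on \<open>n\<close>.\<close>

lemma riemann_error_tendsto:
  assumes "e > 0"
  obtains d where "d > 0"
    "\<And>h n. 0 < h \<Longrightarrow> h < d \<Longrightarrow> real n * h \<ge> B \<Longrightarrow> \<bar>riemann_error n h + W 0 / 2\<bar> \<le> e"
proof -
  have "uniformly_continuous_on {0..B+1} W'"
    by (intro compact_uniformly_continuous continuous_on_subset[OF W'_cont]) auto
  moreover have "e / (B + 1) > 0" using assms B_pos by simp
  ultimately obtain d where d: "d > 0"
    "\<And>x y. x \<in> {0..B+1} \<Longrightarrow> y \<in> {0..B+1} \<Longrightarrow> dist y x < d \<Longrightarrow> dist (W' y) (W' x) < e / (B + 1)"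
    unfolding uniformly_continuous_on_def by meson
  show ?thesis
  proof (rule that[of "min 1 d"])
    fix h n assume h: "0 < h" "h < min 1 d" and n: "real n * h \<ge> B"
    have "2 * \<bar>riemann_error n h + W 0 / 2\<bar> \<le> 2 * ((B + h) * (e / (B + 1)) / 2)"
    proof (intro mult_left_mono composite_trapezoid_error[OF h(1) _ n])
      fix x y :: real assume *: "x \<ge> 0" "y \<ge> 0" "x \<le> B + h" "y \<le> B + h" "\<bar>x - y\<bar> \<le> h"
      hence "dist (W' x) (W' y) < e / (B + 1)" using h by (intro d(2)) (auto simp: dist_real_def)
      thus "\<bar>W' x - W' y\<bar> \<le> e / (B + 1)" by (simp add: dist_real_def)
    qed simp
    also have "2 * ((B + h) * (e / (B + 1)) / 2) = (B + h) * (e / (B + 1))"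
      by (simp only: mult_2 field_sum_of_halves)
    also have "(B + h) * (e / (B + 1)) \<le> (B + 1) * (e / (B + 1))"
      using h assms B_pos by (intro mult_right_mono) auto
    also have "\<dots> = e" using B_pos by simp
    finally have "2 * \<bar>riemann_error n h + W 0 / 2\<bar> \<le> e" .
    moreover have "X \<le> e" if "2 * X \<le> e" "X \<ge> 0" for X :: real using that by linarith
    ultimately show "\<bar>riemann_error n h + W 0 / 2\<bar> \<le> e" using abs_ge_zero by blast
  qed (use d in auto)
qed

text \<open>This is the dominating constant for divisors too large for the limit to apply. If
  \<open>h <= B\<close>, the nodes stay in \<open>{0..2*B}\<close> and \<open>W'\<close> oscillates
  by at most \<open>2 * S\<close>. If \<open>h > B\<close>, every node lies beyond the support and
  only \<open>W_int / h\<close> is left.\<close>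

lemma riemann_error_bounded:
  obtains C where "\<And>h n. 0 < h \<Longrightarrow> real n * h \<ge> B \<Longrightarrow> \<bar>riemann_error n h + W 0 / 2\<bar> \<le> C"
proof -
  have "bounded (W' ` {0..2*B})"
    by (intro compact_imp_bounded compact_continuous_image continuous_on_subset[OF W'_cont]) auto
  then obtain S where "\<forall>x\<in>{0..2*B}. \<bar>W' x\<bar> \<le> S"
    unfolding bounded_iff by auto
  hence S: "\<bar>W' x\<bar> \<le> S" if "x \<in> {0..2*B}" for x using that by blast
  have S0: "S \<ge> 0" using S[of 0] B_pos by auto
  show ?thesis
  proof (rule that[of "2 * B * S + \<bar>W_int\<bar> / B + \<bar>W 0\<bar> / 2"])
    fix h n assume h: "0 < h" and n: "real n * h \<ge> B"
    show "\<bar>riemann_error n h + W 0 / 2\<bar> \<le> 2 * B * S + \<bar>W_int\<bar> / B + \<bar>W 0\<bar> / 2"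
    proof (cases "h \<le> B")
      case True
      have "\<bar>riemann_error n h + W 0 / 2\<bar> \<le> (B + h) * (2 * S) / 2"
      proof (rule composite_trapezoid_error[OF h _ n])
        fix x y :: real assume *: "x \<ge> 0" "y \<ge> 0" "x \<le> B + h" "y \<le> B + h" "\<bar>x - y\<bar> \<le> h"
        hence "\<bar>W' x\<bar> \<le> S" "\<bar>W' y\<bar> \<le> S" using True by (auto intro!: S)
        thus "\<bar>W' x - W' y\<bar> \<le> 2 * S" by linarith
      qed
      also have "\<dots> = (B + h) * S" by simp
      also have "\<dots> \<le> 2 * B * S" using True S0 by (intro mult_right_mono) auto
      moreover have "\<bar>W_int\<bar> / B \<ge> 0" using B_pos by simp
      ultimately show ?thesis by linarith
    next
      case False
      have "W (real m * h) = 0" if "m \<in> {1..n}" for m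
      proof (rule W_zero)
        have "1 * h \<le> real m * h" using that h by (intro mult_right_mono) auto
        thus "B \<le> real m * h" using False by linarith
      qed
      hence "riemann_error n h = - (W_int / h)" by (simp add: riemann_error_def)
      moreover have "\<bar>W_int / h\<bar> \<le> \<bar>W_int\<bar> / B"
        using False h B_pos by (simp add: abs_divide divide_left_mono)
      moreover have "2 * B * S \<ge> 0" using B_pos S0 by simp
      ultimately show ?thesis by linarith
    qed
  qed
qed

end

subsection \<open>Sums weighted by \<open>kappa\<close>\<close>

lemma prod_primes_pos: "T \<subseteq> primes_upto N \<Longrightarrow> \<Prod>T > 0"
  by (intro prod_pos) (auto simp: primes_upto_def prime_gt_0_nat)

lemma prod_kappa_coeff_nonneg: "T \<subseteq> primes_upto N \<Longrightarrow> prod kappa_coeff T \<ge> 0"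
  by (intro prod_nonneg) (auto simp: primes_upto_def kappa_coeff_bounds)

lemma sum_Pow_primes_upto:
  "(\<Sum>T\<in>Pow (primes_upto N). prod f T) = (\<Prod>p\<in>primes_upto N. 1 + f p :: real)"
  using prod_add[of "primes_upto N" f "\<lambda>_. 1"] by (simp add: add.commute)

lemma kappa_total_ge:
  "(\<Prod>p\<in>primes_upto n. 1 + kappa_coeff p) \<le> kappa_total"
proof (rule incseq_le[OF _ kappa_total_LIMSEQ])
  show "incseq (\<lambda>n. \<Prod>p\<in>primes_upto n. 1 + kappa_coeff p)"
    by (intro incseq_SucI prod_mono2) (auto simp: primes_upto_def kappa_coeff_bounds add_nonneg_nonneg)
qed

context compact_C1
begin

lemma sum_multiples:
  assumes X: "X > 0" and N: "real N \<ge> B * X" and d: "d > 0"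
  shows "(\<Sum>y=1..N. if d dvd y then W (real y / X) else 0) = riemann_error N (real d / X) + W_int * X / real d"
proof -
  have "(\<Sum>y=1..N. if d dvd y then W (real y / X) else 0) = (\<Sum>y | y \<in> {1..N} \<and> d dvd y. W (real y / X))"
    by (subst sum.inter_filter) auto
  also have "{y. y \<in> {1..N} \<and> d dvd y} = (\<lambda>m. m * d) ` {m. m \<in> {1..N} \<and> m * d \<le> N}"
  proof (intro set_eqI iffI)
    fix y assume "y \<in> {y. y \<in> {1..N} \<and> d dvd y}"
    then obtain m where m: "y = m * d" "y \<in> {1..N}" by (auto simp: mult.commute)
    moreover have "m \<le> m * d" using d by simp
    hence "m \<le> N" using m by (metis atLeastAtMost_iff order.trans)
    ultimately show "y \<in> (\<lambda>m. m * d) ` {m. m \<in> {1..N} \<and> m * d \<le> N}"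
      by (intro image_eqI[of _ _ m]) auto
  qed (use d in auto)
  also have "(\<Sum>y\<in>(\<lambda>m. m * d) ` {m. m \<in> {1..N} \<and> m * d \<le> N}. W (real y / X))
      = (\<Sum>m | m \<in> {1..N} \<and> m * d \<le> N. W (real m * (real d / X)))"
    by (subst sum.reindex) (use d in \<open>auto simp: inj_on_def\<close>)
  \<comment> \<open>Terms with \<open>m * d > N\<close> lie beyond the support, so the range of
    \<open>m\<close> can be taken the same for all \<open>d\<close>.\<close>
  also have "\<dots> = (\<Sum>m=1..N. W (real m * (real d / X)))"
  proof (rule sum.mono_neutral_left)
    show "\<forall>m\<in>{1..N} - {m. m \<in> {1..N} \<and> m * d \<le> N}. W (real m * (real d / X)) = 0"
    proof
      fix m assume "m \<in> {1..N} - {m. m \<in> {1..N} \<and> m * d \<le> N}"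
      hence "N \<le> m * d" by auto
      hence "real N \<le> real m * real d" by (metis of_nat_le_iff of_nat_mult)
      hence "B * X \<le> real m * real d" using N by linarith
      hence "B \<le> real m * (real d / X)" using X by (simp add: pos_le_divide_eq)
      thus "W (real m * (real d / X)) = 0" by (rule W_zero)
    qed
  qed auto
  finally show ?thesis by (simp add: riemann_error_def)
qed

text \<open>Grouping the \<open>y\<close> by the sets of primes dividing them turns the weighted sum into Riemann
  sums over the multiples of squarefree numbers.\<close>

lemma kappa_sum_eq:
  assumes X: "X > 0" and N: "real N \<ge> B * X"
  shows "(\<Sum>y=1..N. kappa y * W (real y / X)) =
    W_int * X * (\<Prod>p\<in>primes_upto N. 1 + kappa_coeff p / real p) +
    (\<Sum>T\<in>Pow (primes_upto N). prod kappa_coeff T * riemann_error N (real (\<Prod>T) / X))"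
proof -
  let ?P = "Pow (primes_upto N)"
  have fin: "finite ?P" by simp
  have "(\<Sum>y=1..N. kappa y * W (real y / X))
      = (\<Sum>y=1..N. \<Sum>T\<in>?P. prod kappa_coeff T * (if \<Prod>T dvd y then W (real y / X) else 0))"
  proof (intro sum.cong refl)
    fix y assume y: "y \<in> {1..N}"
    have "kappa y = (\<Sum>T | T \<in> ?P \<and> \<Prod>T dvd y. prod kappa_coeff T)"
      using y by (subst kappa_eq_sum[of y N]) (auto simp: Pow_def)
    also have "\<dots> = (\<Sum>T\<in>?P. if \<Prod>T dvd y then prod kappa_coeff T else 0)"
      by (rule sum.inter_filter[OF fin])
    finally show "kappa y * W (real y / X)
        = (\<Sum>T\<in>?P. prod kappa_coeff T * (if \<Prod>T dvd y then W (real y / X) else 0))"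
      by (simp add: sum_distrib_right) (intro sum.cong, auto)
  qed
  also have "\<dots> = (\<Sum>T\<in>?P. prod kappa_coeff T * (\<Sum>y=1..N. if \<Prod>T dvd y then W (real y / X) else 0))"
    by (subst sum.swap) (simp add: sum_distrib_left)
  also have "\<dots> = (\<Sum>T\<in>?P. W_int * X * (\<Prod>p\<in>T. kappa_coeff p / real p)
      + prod kappa_coeff T * riemann_error N (real (\<Prod>T) / X))"
  proof (intro sum.cong refl)
    fix T assume "T \<in> ?P"
    hence T: "\<Prod>T > 0" using prod_primes_pos by blast
    show "prod kappa_coeff T * (\<Sum>y=1..N. if \<Prod>T dvd y then W (real y / X) else 0)
      = W_int * X * (\<Prod>p\<in>T. kappa_coeff p / real p) + prod kappa_coeff T * riemann_error N (real (\<Prod>T) / X)"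
      unfolding sum_multiples[OF X N T] prod_dividef by (simp add: algebra_simps)
  qed
  also have "\<dots> = W_int * X * (\<Sum>T\<in>?P. \<Prod>p\<in>T. kappa_coeff p / real p) +
      (\<Sum>T\<in>?P. prod kappa_coeff T * riemann_error N (real (\<Prod>T) / X))"
    by (simp add: sum.distrib sum_distrib_left)
  finally show ?thesis by (simp only: sum_Pow_primes_upto)
qed

definition kappa_sum :: "real \<Rightarrow> real" where
  "kappa_sum X = (\<Sum>y=1..nat \<lceil>B * X\<rceil>. kappa y * W (real y / X))"

lemma kappa_sum_upto:
  assumes X: "X > 0" and N: "real N \<ge> B * X"
  shows "kappa_sum X = (\<Sum>y=1..N. kappa y * W (real y / X))"
  unfolding kappa_sum_def
proof (rule sum.mono_neutral_left)
  show "{1..nat \<lceil>B * X\<rceil>} \<subseteq> {1..N}"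
    using N by (auto simp: ceiling_le_iff)
  show "\<forall>y\<in>{1..N} - {1..nat \<lceil>B * X\<rceil>}. kappa y * W (real y / X) = 0"
  proof
    fix y assume "y \<in> {1..N} - {1..nat \<lceil>B * X\<rceil>}"
    hence "B * X \<le> real y" by simp linarith
    hence "B \<le> real y / X" using X by (simp add: pos_le_divide_eq)
    thus "kappa y * W (real y / X) = 0" by (simp add: W_zero)
  qed
qed auto

text \<open>The sets \<open>T\<close> are split according to whether all their primes are at most
  \<open>N0\<close>. Those that pass have product at most that of all primes up to
  \<open>N0\<close>, so their step is small and the fine bound \<eta> applies. The others get the
  crude bound \<open>C\<close>, against a total weight that is a tail of
  \<open>kappa_total\<close>.\<close>

lemma kappa_sum_error_le:
  assumes X: "X > 0" and N: "real N \<ge> B * X" and N0: "N0 \<le> N"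
    and C: "\<And>h n. 0 < h \<Longrightarrow> real n * h \<ge> B \<Longrightarrow> \<bar>riemann_error n h + W 0 / 2\<bar> \<le> C"
    and \<eta>: "\<And>h n. 0 < h \<Longrightarrow> h \<le> real (\<Prod>(primes_upto N0)) / X \<Longrightarrow> real n * h \<ge> B \<Longrightarrow>
      \<bar>riemann_error n h + W 0 / 2\<bar> \<le> \<eta>"
  shows "\<bar>kappa_sum X - W_int * X * (\<Prod>p\<in>primes_upto N. 1 + kappa_coeff p / real p)
      + W 0 / 2 * (\<Prod>p\<in>primes_upto N. 1 + kappa_coeff p)\<bar>
    \<le> \<eta> * (\<Prod>p\<in>primes_upto N0. 1 + kappa_coeff p)
      + C * ((\<Prod>p\<in>primes_upto N. 1 + kappa_coeff p) - (\<Prod>p\<in>primes_upto N0. 1 + kappa_coeff p))"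
proof -
  let ?P = "\<lambda>N. Pow (primes_upto N)"
  let ?g = "\<lambda>T. prod kappa_coeff T"
  let ?r = "\<lambda>T. riemann_error N (real (\<Prod>T) / X) + W 0 / 2"
  have sub: "?P N0 \<subseteq> ?P N" using N0 by (auto simp: primes_upto_def)
  have T: "real (\<Prod>T) / X > 0 \<and> real N * (real (\<Prod>T) / X) \<ge> B" if "T \<in> ?P N" for T
  proof -
    have d: "\<Prod>T > 0" using prod_primes_pos that by blast
    hence d1: "real (\<Prod>T) \<ge> 1" by linarith
    hence "real N * 1 \<le> real N * real (\<Prod>T)" by (intro mult_left_mono) auto
    hence "B * X \<le> real N * real (\<Prod>T)" using N by linarith
    thus ?thesis using d1 X by (simp add: pos_le_divide_eq del: of_nat_prod)
  qed
  have "kappa_sum X - W_int * X * (\<Prod>p\<in>primes_upto N. 1 + kappa_coeff p / real p)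
      + W 0 / 2 * (\<Prod>p\<in>primes_upto N. 1 + kappa_coeff p)
    = (\<Sum>T\<in>?P N. ?g T * riemann_error N (real (\<Prod>T) / X)) + W 0 / 2 * (\<Sum>T\<in>?P N. ?g T)"
    unfolding kappa_sum_upto[OF X N] kappa_sum_eq[OF X N] sum_Pow_primes_upto by simp
  also have "\<dots> = (\<Sum>T\<in>?P N. ?g T * ?r T)"
    by (simp add: sum.distrib sum_distrib_left distrib_left mult.commute)
  also have "\<bar>\<dots>\<bar> \<le> (\<Sum>T\<in>?P N. \<bar>?g T * ?r T\<bar>)" by (rule sum_abs)
  also have "\<dots> = (\<Sum>T\<in>?P N0. \<bar>?g T * ?r T\<bar>) + (\<Sum>T\<in>?P N - ?P N0. \<bar>?g T * ?r T\<bar>)"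
    using sum.subset_diff[OF sub, of "\<lambda>T. \<bar>?g T * ?r T\<bar>"] by simp
  also have "\<dots> \<le> (\<Sum>T\<in>?P N0. \<eta> * ?g T) + (\<Sum>T\<in>?P N - ?P N0. C * ?g T)"
  proof (intro add_mono sum_mono)
    fix T assume T0: "T \<in> ?P N0"
    hence TN: "T \<in> ?P N" using sub by blast
    have "\<Prod>T dvd \<Prod>(primes_upto N0)" using T0 by (intro prod_dvd_prod_subset) auto
    hence "\<Prod>T \<le> \<Prod>(primes_upto N0)" using prod_primes_pos[OF subset_refl] by (rule dvd_imp_le)
    hence "real (\<Prod>T) / X \<le> real (\<Prod>(primes_upto N0)) / X"
      using X by (intro divide_right_mono) (simp_all only: of_nat_le_iff less_imp_le)
    hence "\<bar>?r T\<bar> \<le> \<eta>" using T[OF TN] by (intro \<eta>) auto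
    thus "\<bar>?g T * ?r T\<bar> \<le> \<eta> * ?g T"
      using prod_kappa_coeff_nonneg[of T N0] T0 by (simp add: abs_mult mult_left_mono mult.commute[of \<eta>])
  next
    fix T assume T1: "T \<in> ?P N - ?P N0"
    hence "\<bar>?r T\<bar> \<le> C" using T[of T] by (intro C) auto
    thus "\<bar>?g T * ?r T\<bar> \<le> C * ?g T"
      using prod_kappa_coeff_nonneg[of T N] T1 by (simp add: abs_mult mult_left_mono mult.commute[of C])
  qed
  also have "(\<Sum>T\<in>?P N - ?P N0. C * ?g T) = C * ((\<Sum>T\<in>?P N. ?g T) - (\<Sum>T\<in>?P N0. ?g T))"
    using sub by (simp add: sum_diff sum_distrib_left[symmetric])
  finally show ?thesis by (simp only: sum_Pow_primes_upto sum_distrib_left[symmetric])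
qed

text \<open>The truncated mean is multiplied by \<open>X\<close>, so its truncation error must be
  gone before \<open>X\<close> grows: the split at \<open>N0\<close> is fixed first, then for each
  large \<open>X\<close> the cutoff \<open>N\<close> tends to infinity with \<open>X\<close> fixed.
  The bound of \<open>kappa_sum_error_le\<close> survives this since \<open>kappa_sum X\<close> does
  not involve \<open>N\<close>.\<close>

lemma kappa_sum_asymptotics:
  "((\<lambda>X. kappa_sum X - W_int * X * kappa_mean) \<longlongrightarrow> - (W 0 / 2 * kappa_total)) at_top"
proof (rule tendstoI)
  fix e :: real assume e: "e > 0"
  let ?G = "\<lambda>n. \<Prod>p\<in>primes_upto n. 1 + kappa_coeff p"
  obtain C where C: "\<And>h n. 0 < h \<Longrightarrow> real n * h \<ge> B \<Longrightarrow> \<bar>riemann_error n h + W 0 / 2\<bar> \<le> C"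
    using riemann_error_bounded by metis
  obtain n0 where n0: "real n0 \<ge> B" using real_arch_simple by blast
  have C0: "C \<ge> 0" using C[of 1 n0] n0 by auto
  have "primes_upto 0 = {}" by (auto simp: primes_upto_def)
  hence "?G 0 = 1" by simp
  hence total: "kappa_total \<ge> 1" using kappa_total_ge[of 0] by simp
  have "\<forall>\<^sub>F n in sequentially. dist (?G n) kappa_total < e / (3 * (C + 1))"
    using kappa_total_LIMSEQ e C0 by (intro tendstoD) auto
  then obtain N0 where N0: "dist (?G N0) kappa_total < e / (3 * (C + 1))"
    by (auto simp: eventually_sequentially)
  have "C * (kappa_total - ?G N0) \<le> (C + 1) * (e / (3 * (C + 1)))"
    using N0 kappa_total_ge[of N0] C0 by (intro mult_mono) (auto simp: dist_real_def)
  also have "\<dots> = e / 3" using C0 by (simp add: field_simps)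
  finally have tail: "C * (kappa_total - ?G N0) \<le> e / 3" .
  \<comment> \<open>One third of \<open>e\<close> for the small divisors, one third for the tail.
    The last third keeps the inequality strict, as the limit in \<open>N\<close> preserves only weak
    ones.\<close>
  define \<eta> where "\<eta> = e / (3 * kappa_total)"
  have "\<eta> > 0" using e total by (simp add: \<eta>_def)
  then obtain d where d: "d > 0"
    "\<And>h n. 0 < h \<Longrightarrow> h < d \<Longrightarrow> real n * h \<ge> B \<Longrightarrow> \<bar>riemann_error n h + W 0 / 2\<bar> \<le> \<eta>"
    using riemann_error_tendsto by metis
  define Q where "Q = real (\<Prod>(primes_upto N0))"
  have Q: "Q > 0" unfolding Q_def using prod_primes_pos[OF subset_refl, of N0] by linarith
  show "\<forall>\<^sub>F X in at_top. dist (kappa_sum X - W_int * X * kappa_mean) (- (W 0 / 2 * kappa_total)) < e"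
    using eventually_gt_at_top[of "Q / d"]
  proof eventually_elim
    case (elim X)
    moreover have "Q / d > 0" using Q d(1) by simp
    ultimately have "X > 0" by linarith
    with elim have X: "X > 0" "Q / X < d"
      using d(1) by (simp_all add: pos_divide_less_eq mult.commute)
    let ?K = "\<lambda>n. \<Prod>p\<in>primes_upto n. 1 + kappa_coeff p / real p"
    have "(\<lambda>N. \<bar>kappa_sum X - W_int * X * ?K N + W 0 / 2 * ?G N\<bar>)
      \<longlonglongrightarrow> \<bar>kappa_sum X - W_int * X * kappa_mean + W 0 / 2 * kappa_total\<bar>"
      by (intro tendsto_intros kappa_mean_LIMSEQ kappa_total_LIMSEQ)
    moreover obtain N1 where N1: "real N1 \<ge> B * X" using real_arch_simple by blast
    have "\<bar>kappa_sum X - W_int * X * ?K N + W 0 / 2 * ?G N\<bar> \<le> 2 * e / 3" if N: "N \<ge> max N0 N1" for N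
    proof -
      have "\<bar>kappa_sum X - W_int * X * ?K N + W 0 / 2 * ?G N\<bar> \<le> \<eta> * ?G N0 + C * (?G N - ?G N0)"
      proof (rule kappa_sum_error_le[OF X(1) _ _ C])
        fix h n assume "0 < h" "h \<le> real (\<Prod>(primes_upto N0)) / X" "real n * h \<ge> B"
        thus "\<bar>riemann_error n h + W 0 / 2\<bar> \<le> \<eta>"
          using X(2) unfolding Q_def by (intro d(2)) linarith+
      qed (use N N1 in auto)
      also have "\<eta> * ?G N0 \<le> \<eta> * kappa_total"
        using \<open>\<eta> > 0\<close> kappa_total_ge by (intro mult_left_mono) auto
      also have "\<eta> * kappa_total = e / 3" using total by (simp add: \<eta>_def)
      also have "C * (?G N - ?G N0) \<le> C * (kappa_total - ?G N0)"
        using C0 kappa_total_ge by (intro mult_left_mono) auto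
      finally show ?thesis using tail by linarith
    qed
    hence "\<exists>N2. \<forall>N\<ge>N2. \<bar>kappa_sum X - W_int * X * ?K N + W 0 / 2 * ?G N\<bar> \<le> 2 * e / 3" by blast
    ultimately have "\<bar>kappa_sum X - W_int * X * kappa_mean + W 0 / 2 * kappa_total\<bar> \<le> 2 * e / 3"
      by (rule LIMSEQ_le_const2)
    thus ?case using e by (simp add: dist_real_def)
  qed
qed

end

subsection \<open>The averaged inverse square root\<close>

text \<open>With \<Xi> = X / u, the square root in \<open>M_fun\<close> is this kernel at
  \<open>y * sqrt (u / X)\<close>, and the value 0 outside (-2, 2) encodes the range of summation.
  Being even, it also gives \<open>W\<close> a meaning on both sides of 0.\<close>

definition arcsine_kernel :: "real \<Rightarrow> real" where
  "arcsine_kernel x = (if \<bar>x\<bar> < 2 then 1 / sqrt (4 - x\<^sup>2) else 0)"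

lemma arcsine_kernel_nonneg: "arcsine_kernel x \<ge> 0"
proof (cases "\<bar>x\<bar> < 2")
  case True
  hence "\<bar>x\<bar> ^ 2 < 2 ^ 2" by (intro power_strict_mono) auto
  thus ?thesis by (simp add: arcsine_kernel_def)
qed (simp add: arcsine_kernel_def)

lemma arcsine_kernel_eq_0: "x \<ge> 2 \<Longrightarrow> arcsine_kernel x = 0"
  by (simp add: arcsine_kernel_def)

lemma borel_measurable_arcsine_kernel [measurable]: "arcsine_kernel \<in> borel_measurable borel"
  unfolding arcsine_kernel_def[abs_def] by measurable

lemma arcsine_kernel_scaled:
  assumes "t \<ge> 0" "u > 0"
  shows "arcsine_kernel (t * sqrt u) = (if t\<^sup>2 * u < 4 then 1 / sqrt (4 - t\<^sup>2 * u) else 0)"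
proof -
  have "(t * sqrt u) < 2 \<longleftrightarrow> (t * sqrt u)\<^sup>2 < 2\<^sup>2"
    using power_strict_mono[of "t * sqrt u" 2 2] power_less_imp_less_base[of "t * sqrt u" 2 2] assms
    by fastforce
  moreover have "(t * sqrt u)\<^sup>2 = t\<^sup>2 * u" using assms by (simp add: power_mult_distrib)
  ultimately show ?thesis using assms by (simp add: arcsine_kernel_def)
qed

lemma nn_integral_arcsine_kernel:
  assumes s: "s > 0"
  shows "(\<integral>\<^sup>+ t. indicator {0..} t * ennreal (arcsine_kernel (t * s)) \<partial>lborel) = ennreal (pi / 2 / s)"
proof -
  have "((\<lambda>t. arcsine_kernel (t * s)) has_integral
      (arcsin (2 / s * s / 2) / s - arcsin (0 * s / 2) / s)) {0..2 / s}"
  \<comment> \<open>The derivative of arcsin blows up at the right end, so it is required only in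
    the interior; continuity of arcsin covers the end points.\<close>
  proof (rule fundamental_theorem_of_calculus_interior)
    show "continuous_on {0..2 / s} (\<lambda>t. arcsin (t * s / 2) / s)"
      using s by (intro continuous_intros) (auto simp: field_simps intro: order.trans[of _ 0])
    fix t assume t: "t \<in> {0<..<2 / s}"
    hence ts: "0 < t * s" "t * s < 2" using s by (auto simp: field_simps)
    have "sqrt (1 - (t * s / 2)\<^sup>2) = sqrt ((4 - (t * s)\<^sup>2) / 4)" by (simp add: power_divide field_simps)
    also have "\<dots> = sqrt (4 - (t * s)\<^sup>2) / 2" by (simp add: real_sqrt_divide)
    finally have eq: "sqrt (1 - (t * s / 2)\<^sup>2) = sqrt (4 - (t * s)\<^sup>2) / 2" .
    have "((\<lambda>t. arcsin (t * s / 2) / s) has_real_derivative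
        (inverse (sqrt (1 - (t * s / 2)\<^sup>2)) * (s / 2)) / s) (at t)"
      using ts s by (auto intro!: derivative_eq_intros)
    also have "(inverse (sqrt (1 - (t * s / 2)\<^sup>2)) * (s / 2)) / s = arcsine_kernel (t * s)"
      unfolding eq using ts s by (simp add: arcsine_kernel_def field_simps)
    finally show "((\<lambda>t. arcsin (t * s / 2) / s) has_vector_derivative arcsine_kernel (t * s)) (at t)"
      by (simp add: has_real_derivative_iff_has_vector_derivative)
  qed (use s in auto)
  hence "((\<lambda>t. arcsine_kernel (t * s)) has_integral (pi / 2 / s)) {0..2 / s}" using s by simp
  from nn_integral_has_integral_lebesgue[OF _ this]
  have "(\<integral>\<^sup>+ t. ennreal (indicator {0..2 / s} t * arcsine_kernel (t * s)) \<partial>lborel) = ennreal (pi / 2 / s)"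
    using arcsine_kernel_nonneg by simp
  moreover have "ennreal (indicator {0..2 / s} t * arcsine_kernel (t * s))
      = indicator {0..} t * ennreal (arcsine_kernel (t * s))" for t
    using s by (auto simp: indicator_def arcsine_kernel_def field_simps)
  ultimately show ?thesis by simp
qed

locale compact_weight =
  fixes F F' :: "real \<Rightarrow> real" and a b :: real
  assumes a_pos: "a > 0" and a_le_b: "a \<le> b"
    and F_nonneg: "F u \<ge> 0"
    and F_deriv: "(F has_real_derivative F' u) (at u)"
    and F'_cont: "continuous_on UNIV F'"
    and F_zero: "u < a \<or> u > b \<Longrightarrow> F u = 0"
begin

text \<open>Here \<open>sqrt u\<close> is \<open>u powr (3/2) / u\<close>, and \<open>t\<close>
  stands for \<open>y / sqrt X\<close>.\<close>

definition W :: "real \<Rightarrow> real" where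
  "W t = (LBINT u. F u * sqrt u * arcsine_kernel (t * sqrt u))"

definition B :: real where "B = 2 / sqrt a"

definition W_sin :: "real \<Rightarrow> real \<Rightarrow> real" where
  "W_sin t \<theta> = 8 * (sin \<theta>)\<^sup>2 / t ^ 3 * F (4 * (sin \<theta>)\<^sup>2 / t\<^sup>2)"

lemma F_cont: "continuous_on A F"
  using F_deriv by (intro DERIV_continuous_on) (blast intro: DERIV_subset)

lemma F_meas [measurable]: "F \<in> borel_measurable borel"
  by (rule borel_measurable_continuous_onI[OF F_cont])

lemma W_sin_cont:
  assumes "t > 0" shows "continuous_on A (W_sin t)"
  unfolding W_sin_def[abs_def] using assms
  by (intro continuous_intros continuous_on_compose2[OF F_cont[of UNIV]]) auto

text \<open>The substitution \<open>u = (2 sin \<theta> / t)\<^sup>2\<close> removes the inverse square root singularity.\<close>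

lemma
  assumes t: "t > 0"
  shows W_integrable_pos: "integrable lborel (\<lambda>u. F u * sqrt u * arcsine_kernel (t * sqrt u))"
    and W_eq_sin: "W t = integral {0..pi / 2} (W_sin t)"
proof -
  define f where "f u = F u * sqrt u / sqrt (4 - t\<^sup>2 * u)" for u
  define g where "g \<theta> = 4 * (sin \<theta>)\<^sup>2 / t\<^sup>2" for \<theta>
  define g' where "g' \<theta> = 8 * sin \<theta> * cos \<theta> / t\<^sup>2" for \<theta>
  have pos: "sin \<theta> > 0" "cos \<theta> > 0" if "0 < \<theta>" "\<theta> < pi / 2" for \<theta>
    using that by (auto intro!: sin_gt_zero cos_gt_zero)
  have four: "4 - t\<^sup>2 * g \<theta> = (2 * cos \<theta>)\<^sup>2" for \<theta>
    using t by (simp add: g_def power_mult_distrib cos_squared_eq algebra_simps)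
  have fg: "f (g \<theta>) * g' \<theta> = W_sin t \<theta>" if th: "0 < \<theta>" "\<theta> < pi / 2" for \<theta>
  proof -
    have "g \<theta> = (2 * sin \<theta> / t)\<^sup>2" by (simp add: g_def power_mult_distrib power_divide)
    hence "sqrt (g \<theta>) = 2 * sin \<theta> / t" using pos[OF th] t by (simp add: real_sqrt_abs)
    moreover have "sqrt (4 - t\<^sup>2 * g \<theta>) = 2 * cos \<theta>"
      unfolding four real_sqrt_abs using pos[OF th] by simp
    ultimately have "f (g \<theta>) * g' \<theta> = F (g \<theta>) * (2 * sin \<theta> / t) / (2 * cos \<theta>) * (8 * sin \<theta> * cos \<theta> / t\<^sup>2)"
      by (simp add: f_def g'_def)
    also have "\<dots> = 8 * (sin \<theta>)\<^sup>2 / t ^ 3 * F (g \<theta>)"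
      using pos[OF th] t by (simp add: power2_eq_square power3_eq_cube mult_ac)
    finally show ?thesis by (simp add: W_sin_def g_def)
  qed
  have sint: "set_integrable lborel {0..pi / 2} (W_sin t)"
    by (intro borel_integrable_atLeastAtMost' W_sin_cont t)
  have int_fg: "set_integrable lborel (einterval 0 (pi / 2)) (\<lambda>\<theta>. f (g \<theta>) * g' \<theta>)"
  proof -
    have "set_integrable lborel (einterval 0 (pi / 2)) (W_sin t)"
      by (rule set_integrable_subset[OF sint]) (auto simp: einterval_def zero_ereal_def)
    thus ?thesis
      by (rule set_integrable_cong[THEN iffD1, rotated -1]) (auto simp: einterval_def zero_ereal_def fg)
  qed
  have lim0: "((ereal \<circ> g \<circ> real_of_ereal) \<longlongrightarrow> 0) (at_right 0)"
  proof -
    have "(g \<longlongrightarrow> g 0) (at_right 0)" unfolding g_def[abs_def] using t by (intro tendsto_intros) auto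
    hence "((\<lambda>x. ereal (g x)) \<longlongrightarrow> ereal (g 0)) (at_right 0)" by (rule tendsto_ereal)
    thus ?thesis unfolding zero_ereal_def ereal_tendsto_simps1 by (simp add: o_def g_def)
  qed
  have lim1: "((ereal \<circ> g \<circ> real_of_ereal) \<longlongrightarrow> ereal (4 / t\<^sup>2)) (at_left (ereal (pi / 2)))"
  proof -
    have "(g \<longlongrightarrow> g (pi / 2)) (at_left (pi / 2))" unfolding g_def[abs_def] using t by (intro tendsto_intros) auto
    hence "((\<lambda>x. ereal (g x)) \<longlongrightarrow> ereal (g (pi / 2))) (at_left (pi / 2))" by (rule tendsto_ereal)
    thus ?thesis unfolding ereal_tendsto_simps1 by (simp add: o_def g_def)
  qed
  have deriv: "DERIV g \<theta> :> g' \<theta>" for \<theta>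
    unfolding g_def[abs_def] g'_def using t
    by (auto intro!: derivative_eq_intros simp: power4_eq_xxxx power2_eq_square)
  have cont': "isCont g' \<theta>" for \<theta>
    unfolding g'_def[abs_def] using t by (intro continuous_intros) auto
  have cont: "isCont f (g \<theta>)" and nonneg: "0 \<le> f (g \<theta>)"
    if "0 < ereal \<theta>" "ereal \<theta> < ereal (pi / 2)" for \<theta>
  proof -
    have th: "0 < \<theta>" "\<theta> < pi / 2" using that by auto
    have "4 - t\<^sup>2 * g \<theta> > 0" unfolding four using pos[OF th] by simp
    moreover have "isCont F (g \<theta>)" using F_deriv DERIV_isCont by blast
    ultimately show "isCont f (g \<theta>)" unfolding f_def[abs_def]
      by (intro continuous_intros) auto
    have "g \<theta> \<ge> 0" by (simp add: g_def)
    thus "0 \<le> f (g \<theta>)" unfolding f_def four using F_nonneg by simp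
  qed
  have nonneg': "0 \<le> g' \<theta>" if "0 \<le> ereal \<theta>" "ereal \<theta> \<le> ereal (pi / 2)" for \<theta>
    using that unfolding g'_def
    by (auto intro!: divide_nonneg_nonneg mult_nonneg_nonneg sin_ge_zero cos_ge_zero)
  \<comment> \<open>The singularity \<open>u = 4 / t^2\<close> of \<open>f\<close> corresponds to
    \<theta> = pi / 2, hence a substitution on open intervals with limits at the ends. In its
    nonnegative form it also yields integrability of the original integrand.\<close>
  have "(0::ereal) < ereal (pi / 2)" by simp
  note subst = interval_integral_substitution_nonneg[OF this deriv cont cont' nonneg nonneg' lim0 lim1 int_fg]
  note subst1 = subst(1) and subst2 = subst(2)
  have ind: "F u * sqrt u * arcsine_kernel (t * sqrt u) = indicator {0<..<4 / t\<^sup>2} u *\<^sub>R f u" for u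
  proof (cases "u > 0")
    case True
    thus ?thesis using t by (auto simp: arcsine_kernel_scaled f_def indicator_def field_simps)
  next
    case False
    hence "F u = 0" using a_pos by (intro F_zero) auto
    thus ?thesis using False by simp
  qed
  have ein: "einterval 0 (ereal (4 / t\<^sup>2)) = {0<..<4 / t\<^sup>2}" by (auto simp: einterval_def zero_ereal_def)
  show "integrable lborel (\<lambda>u. F u * sqrt u * arcsine_kernel (t * sqrt u))"
    using subst1 unfolding ind set_integrable_def ein .
  have "W t = (LBINT x=0..4 / t\<^sup>2. f x)"
    using t unfolding W_def ind
    by (simp add: interval_lebesgue_integral_def set_lebesgue_integral_def ein zero_ereal_def)
  also note subst2
  also have "(LBINT \<theta>=0..ereal (pi / 2). f (g \<theta>) * g' \<theta>) = (LBINT \<theta>=0..ereal (pi / 2). W_sin t \<theta>)"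
    by (rule interval_integral_cong) (auto simp: einterval_def zero_ereal_def fg)
  also have "\<dots> = integral {0..pi / 2} (W_sin t)"
    using interval_integral_eq_integral[of 0 "pi / 2" "W_sin t"] sint by (simp add: zero_ereal_def)
  finally show "W t = integral {0..pi / 2} (W_sin t)" .
qed

definition W_sin' :: "real \<Rightarrow> real \<Rightarrow> real" where
  "W_sin' t \<theta> = 8 * (sin \<theta>)\<^sup>2 / t ^ 3 * (F' (4 * (sin \<theta>)\<^sup>2 / t\<^sup>2) * (- 8 * (sin \<theta>)\<^sup>2 / t ^ 3))
     - 24 * (sin \<theta>)\<^sup>2 / t ^ 4 * F (4 * (sin \<theta>)\<^sup>2 / t\<^sup>2)"

lemma W_sin'_cont: "continuous_on ({0<..} \<times> cbox 0 (pi / 2)) (\<lambda>(t, \<theta>). W_sin' t \<theta>)"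
  unfolding W_sin'_def split_beta
  by (intro continuous_intros continuous_on_compose2[OF F_cont[of UNIV]] continuous_on_compose2[OF F'_cont]) auto

lemma W_deriv_pos:
  assumes t: "t > 0"
  shows "(W has_real_derivative integral {0..pi / 2} (W_sin' t)) (at t)"
proof -
  have "((\<lambda>t. integral (cbox 0 (pi / 2)) (W_sin t)) has_field_derivative
      integral (cbox 0 (pi / 2)) (W_sin' t)) (at t within {0<..})"
  proof (rule leibniz_rule_field_derivative[OF _ _ W_sin'_cont])
    fix t \<theta> :: real assume t: "t \<in> {0<..}"
    have "((\<lambda>t. F (4 * (sin \<theta>)\<^sup>2 / t\<^sup>2)) has_real_derivative
        F' (4 * (sin \<theta>)\<^sup>2 / t\<^sup>2) * (- 8 * (sin \<theta>)\<^sup>2 / t ^ 3)) (at t)"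
      by (rule DERIV_chain2[OF F_deriv])
         (use t in \<open>auto intro!: derivative_eq_intros simp: field_simps power2_eq_square power3_eq_cube\<close>)
    hence "((\<lambda>t. W_sin t \<theta>) has_real_derivative W_sin' t \<theta>) (at t)"
      unfolding W_sin_def W_sin'_def using t
      by (auto intro!: derivative_eq_intros simp: field_simps power2_eq_square power3_eq_cube power4_eq_xxxx)
    thus "((\<lambda>t. W_sin t \<theta>) has_real_derivative W_sin' t \<theta>) (at t within {0<..})"
      by (rule DERIV_subset) auto
  next
    fix t :: real assume "t \<in> {0<..}"
    thus "W_sin t integrable_on cbox 0 (pi / 2)"
      by (intro integrable_continuous W_sin_cont) auto
  qed (use t in auto)
  hence "((\<lambda>t. integral (cbox 0 (pi / 2)) (W_sin t)) has_field_derivative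
      integral {0..pi / 2} (W_sin' t)) (at t)"
    using t by (simp add: at_within_open[of t "{0<..}"])
  thus ?thesis
    by (rule has_field_derivative_transform_within_open[where S = "{0<..}"])
       (use t in \<open>auto simp: W_eq_sin\<close>)
qed

text \<open>The unsubstituted integrand, for \<open>t\<close> so small that the square root stays
  away from 0 on the support of \<open>F\<close>.\<close>

definition W_dir :: "real \<Rightarrow> real \<Rightarrow> real" where
  "W_dir t u = F u * sqrt u / sqrt (4 - t\<^sup>2 * u)"

definition W_dir' :: "real \<Rightarrow> real \<Rightarrow> real" where
  "W_dir' t u = F u * sqrt u * (t * u / (sqrt (4 - t\<^sup>2 * u)) ^ 3)"

text \<open>Chosen so that \<open>t^2 * u <= 1 < 4\<close> for |t| < \<delta> and u <= b. The
  interval around 0 is two-sided to make it open, as the glueing of derivatives and continuity below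
  relies on open sets.\<close>

definition \<delta> :: real where "\<delta> = 1 / sqrt b"

lemma \<delta>_pos: "\<delta> > 0"
  using a_pos a_le_b by (simp add: \<delta>_def)

lemma near_0:
  assumes "t \<in> {-\<delta><..<\<delta>}" "u \<in> {a..b}"
  shows "t\<^sup>2 * u < 4"
proof -
  have "\<bar>t\<bar>\<^sup>2 \<le> \<delta>\<^sup>2" using assms by (intro power_mono) auto
  hence "t\<^sup>2 * u \<le> \<delta>\<^sup>2 * b" using assms a_pos by (intro mult_mono) auto
  also have "\<dots> = 1" using a_pos a_le_b by (simp add: \<delta>_def power_divide)
  finally show ?thesis by simp
qed

lemma W_dir_cont: "t \<in> {-\<delta><..<\<delta>} \<Longrightarrow> continuous_on {a..b} (W_dir t)"
  unfolding W_dir_def[abs_def]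
  by (intro continuous_intros F_cont) (use near_0[of t] in fastforce)

lemma W_dir'_cont: "continuous_on ({-\<delta><..<\<delta>} \<times> cbox a b) (\<lambda>(t, u). W_dir' t u)"
  unfolding W_dir'_def split_beta
  by (intro continuous_intros continuous_on_compose2[OF F_cont[of UNIV]]) (use near_0 in fastforce)+

lemma
  assumes t: "t \<in> {-\<delta><..<\<delta>}"
  shows W_integrable_near_0: "integrable lborel (\<lambda>u. F u * sqrt u * arcsine_kernel (t * sqrt u))"
    and W_eq_dir: "W t = integral {a..b} (W_dir t)"
proof -
  have ind: "F u * sqrt u * arcsine_kernel (t * sqrt u) = indicator {a..b} u *\<^sub>R W_dir t u" for u
  proof (cases "u \<in> {a..b}")
    case True
    hence "u > 0" using a_pos by auto
    \<comment> \<open>Evenness is used because \<open>t\<close> may be negative here, whereas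
      \<open>arcsine_kernel_scaled\<close> assumes \<open>t >= 0\<close>.\<close>
    have "arcsine_kernel (t * sqrt u) = arcsine_kernel (\<bar>t\<bar> * sqrt u)"
      by (auto simp: arcsine_kernel_def abs_mult power_mult_distrib)
    thus ?thesis using near_0[OF t True] True \<open>u > 0\<close> by (simp add: arcsine_kernel_scaled W_dir_def)
  next
    case False
    thus ?thesis by (auto simp: F_zero)
  qed
  have int: "set_integrable lborel {a..b} (W_dir t)"
    by (intro borel_integrable_atLeastAtMost' W_dir_cont t)
  show "integrable lborel (\<lambda>u. F u * sqrt u * arcsine_kernel (t * sqrt u))"
    using int unfolding ind set_integrable_def .
  show "W t = integral {a..b} (W_dir t)"
    using set_borel_integral_eq_integral(2)[OF int] unfolding W_def ind set_lebesgue_integral_def .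
qed

lemma W_deriv_near_0:
  assumes t: "t \<in> {-\<delta><..<\<delta>}"
  shows "(W has_real_derivative integral {a..b} (W_dir' t)) (at t)"
proof -
  have "((\<lambda>t. integral (cbox a b) (W_dir t)) has_field_derivative
      integral (cbox a b) (W_dir' t)) (at t within {-\<delta><..<\<delta>})"
  proof (rule leibniz_rule_field_derivative[OF _ _ W_dir'_cont])
    fix t u :: real assume t: "t \<in> {-\<delta><..<\<delta>}" and u: "u \<in> cbox a b"
    have pos: "4 - t\<^sup>2 * u > 0" using near_0[OF t, of u] u by simp
    have "((\<lambda>t. sqrt (4 - t\<^sup>2 * u)) has_real_derivative
        inverse (sqrt (4 - t\<^sup>2 * u)) / 2 * (- 2 * t * u)) (at t)"
      by (rule DERIV_chain2[where f = sqrt and g = "\<lambda>t. 4 - t\<^sup>2 * u", OF DERIV_real_sqrt[OF pos]])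
         (auto intro!: derivative_eq_intros)
    hence "((\<lambda>t. F u * sqrt u / sqrt (4 - t\<^sup>2 * u)) has_real_derivative
        F u * sqrt u * (- (inverse (sqrt (4 - t\<^sup>2 * u)) / 2 * (- 2 * t * u)) / (sqrt (4 - t\<^sup>2 * u))\<^sup>2)) (at t)"
      using pos by (auto intro!: derivative_eq_intros simp: power2_eq_square)
    also have "- (inverse (sqrt (4 - t\<^sup>2 * u)) / 2 * (- 2 * t * u)) / (sqrt (4 - t\<^sup>2 * u))\<^sup>2
        = t * u / (sqrt (4 - t\<^sup>2 * u)) ^ 3"
      using pos by (simp add: power2_eq_square power3_eq_cube field_simps)
    finally have "((\<lambda>t. W_dir t u) has_real_derivative W_dir' t u) (at t)"
      by (simp only: W_dir_def W_dir'_def)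
    thus "((\<lambda>t. W_dir t u) has_real_derivative W_dir' t u) (at t within {-\<delta><..<\<delta>})"
      by (rule DERIV_subset) auto
  next
    fix t :: real assume "t \<in> {-\<delta><..<\<delta>}"
    thus "W_dir t integrable_on cbox a b"
      unfolding cbox_interval by (intro integrable_continuous_real W_dir_cont)
  qed (use t in auto)
  hence "((\<lambda>t. integral {a..b} (W_dir t)) has_field_derivative
      integral {a..b} (W_dir' t)) (at t)"
    using t by (simp add: at_within_open[of t "{-\<delta><..<\<delta>}"])
  thus ?thesis
    by (rule has_field_derivative_transform_within_open[where S = "{-\<delta><..<\<delta>}"])
       (use t in \<open>auto simp: W_eq_dir\<close>)
qed

lemma W_deriv:
  assumes "t \<ge> 0"
  shows "(W has_real_derivative deriv W t) (at t)"
proof (cases "t > 0")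
  case True
  from W_deriv_pos[OF this] show ?thesis by (metis DERIV_imp_deriv)
next
  case False
  hence "t \<in> {-\<delta><..<\<delta>}" using assms \<delta>_pos by auto
  from W_deriv_near_0[OF this] show ?thesis by (metis DERIV_imp_deriv)
qed

text \<open>Continuity is local, and two open sets cover the closed half-line. Both parametric
  integrals equal \<open>deriv W\<close>, so they agree on the overlap automatically.\<close>

lemma deriv_W_cont: "continuous_on {0..} (deriv W)"
proof (rule continuous_on_subset)
  have "continuous_on {0<..} (\<lambda>t. integral (cbox 0 (pi / 2)) (W_sin' t))"
    by (rule integral_continuous_on_param[OF W_sin'_cont])
  hence 1: "continuous_on {0<..} (deriv W)"
    by (rule continuous_on_eq) (auto intro!: DERIV_imp_deriv[OF W_deriv_pos, symmetric])
  have "continuous_on {-\<delta><..<\<delta>} (\<lambda>t. integral (cbox a b) (W_dir' t))"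
    by (rule integral_continuous_on_param[OF W_dir'_cont])
  hence 2: "continuous_on {-\<delta><..<\<delta>} (deriv W)"
    by (rule continuous_on_eq) (auto intro!: DERIV_imp_deriv[OF W_deriv_near_0, symmetric])
  show "continuous_on ({-\<delta><..<\<delta>} \<union> {0<..}) (deriv W)"
    by (rule continuous_on_open_Un[OF _ _ 2 1]) auto
  show "{0..} \<subseteq> {-\<delta><..<\<delta>} \<union> {0<..}" using \<delta>_pos by auto
qed

lemma W_integrable:
  assumes "t \<ge> 0"
  shows "integrable lborel (\<lambda>u. F u * sqrt u * arcsine_kernel (t * sqrt u))"
  using W_integrable_pos[of t] W_integrable_near_0[of t] assms \<delta>_pos by (cases "t = 0") auto

lemma W_zero:
  assumes "t \<ge> B"
  shows "W t = 0"
proof -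
  have "F u * sqrt u * arcsine_kernel (t * sqrt u) = 0" for u
  proof (cases "u \<ge> a")
    case True
    have "2 = B * sqrt a" using a_pos by (simp add: B_def)
    also have "\<dots> \<le> t * sqrt u"
      using assms True a_pos by (intro mult_mono) (auto simp: B_def intro: order.trans[of _ "2 / sqrt a"])
    finally show ?thesis by (simp add: arcsine_kernel_eq_0)
  qed (simp add: F_zero)
  hence "(\<lambda>u. F u * sqrt u * arcsine_kernel (t * sqrt u)) = (\<lambda>u. 0)" by (rule ext)
  thus ?thesis unfolding W_def by simp
qed

sublocale compact_C1 W "deriv W" B
proof
  show "B > 0" using a_pos by (simp add: B_def)
  show "(W has_real_derivative deriv W t) (at t within {0..})" if "t \<ge> 0" for t
    using W_deriv[OF that] by (rule DERIV_subset) auto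
qed (use W_zero deriv_W_cont in auto)

lemma W_0: "W 0 = (LBINT u. F u * sqrt u) / 2"
  by (simp add: W_def arcsine_kernel_def)

lemma integrable_F_mult:
  assumes "continuous_on {a..b} f"
  shows "integrable lborel (\<lambda>u. F u * f u)"
proof -
  have "set_integrable lborel {a..b} (\<lambda>u. F u * f u)"
    by (intro borel_integrable_atLeastAtMost' continuous_intros F_cont assms)
  moreover have "indicator {a..b} u *\<^sub>R (F u * f u) = F u * f u" for u
    by (cases "u \<in> {a..b}") (auto simp: F_zero)
  ultimately show ?thesis unfolding set_integrable_def by (simp only:)
qed

lemma W_nonneg: "W t \<ge> 0"
proof -
  have "F u * sqrt u * arcsine_kernel (t * sqrt u) \<ge> 0" for u
    using F_nonneg arcsine_kernel_nonneg F_zero[of u] a_pos by (cases "u \<ge> a") auto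
  thus ?thesis unfolding W_def by (intro Bochner_Integration.integral_nonneg)
qed

text \<open>Tonelli: integrating over \<open>t\<close> first gives \<open>pi / 2 / sqrt u\<close>,
  which cancels the factor \<open>sqrt u\<close>. The subtracted term of
  \<open>M_fun (X / u)\<close> loses the same factor, so both involve the plain integral of
  \<open>F\<close>.\<close>

lemma W_int_eq_pi: "W_int = pi / 2 * (LBINT u. F u)"
proof -
  let ?k = "\<lambda>t u. F u * sqrt u * arcsine_kernel (t * sqrt u)"
  have k_nonneg: "?k t u \<ge> 0" for t u
    using F_nonneg arcsine_kernel_nonneg F_zero[of u] a_pos by (cases "u \<ge> a") auto
  have "(W has_integral W_int) {0..B}"
    unfolding W_int_def using W_cont
    by (intro integrable_integral integrable_continuous_real) (auto intro: continuous_on_subset)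
  from nn_integral_has_integral_lebesgue[OF W_nonneg this]
  have "ennreal W_int = (\<integral>\<^sup>+ t. ennreal (indicator {0..B} t * W t) \<partial>lborel)" by simp
  also have "\<dots> = (\<integral>\<^sup>+ t. (\<integral>\<^sup>+ u. indicator {0..} t * ennreal (?k t u) \<partial>lborel) \<partial>lborel)"
  proof (rule nn_integral_cong)
    fix t :: real
    show "ennreal (indicator {0..B} t * W t) = (\<integral>\<^sup>+ u. indicator {0..} t * ennreal (?k t u) \<partial>lborel)"
    proof (cases "t \<ge> 0")
      case True
      have "(\<integral>\<^sup>+ u. indicator {0..} t * ennreal (?k t u) \<partial>lborel) = (\<integral>\<^sup>+ u. ennreal (?k t u) \<partial>lborel)"
        using True by simp
      also have "\<dots> = ennreal (W t)"
        unfolding W_def by (rule nn_integral_eq_integral[OF W_integrable[OF True]]) (use k_nonneg in auto)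
      finally show ?thesis using True W_zero[of t] by (auto simp: indicator_def)
    qed simp
  qed
  also have "\<dots> = (\<integral>\<^sup>+ u. (\<integral>\<^sup>+ t. indicator {0..} t * ennreal (?k t u) \<partial>lborel) \<partial>lborel)"
    by (rule lborel_pair.Fubini'[symmetric]) measurable
  also have "\<dots> = (\<integral>\<^sup>+ u. ennreal (pi / 2 * F u) \<partial>lborel)"
  proof (rule nn_integral_cong)
    fix u :: real
    show "(\<integral>\<^sup>+ t. indicator {0..} t * ennreal (?k t u) \<partial>lborel) = ennreal (pi / 2 * F u)"
    proof (cases "u \<ge> a")
      case True
      hence u: "sqrt u > 0" using a_pos by simp
      have "(\<integral>\<^sup>+ t. indicator {0..} t * ennreal (?k t u) \<partial>lborel)
          = (\<integral>\<^sup>+ t. ennreal (F u * sqrt u) * (indicator {0..} t * ennreal (arcsine_kernel (t * sqrt u))) \<partial>lborel)"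
        using F_nonneg u by (intro nn_integral_cong) (simp add: ennreal_mult' mult_ac)
      also have "\<dots> = ennreal (F u * sqrt u) * ennreal (pi / 2 / sqrt u)"
        by (subst nn_integral_cmult) (auto simp: nn_integral_arcsine_kernel[OF u])
      also have "\<dots> = ennreal (F u * sqrt u * (pi / 2 / sqrt u))"
        using F_nonneg u by (intro ennreal_mult'[symmetric]) auto
      also have "F u * sqrt u * (pi / 2 / sqrt u) = pi / 2 * F u" using u by simp
      finally show ?thesis .
    qed (simp add: F_zero)
  qed
  also have "\<dots> = ennreal (LBINT u. pi / 2 * F u)"
    using integrable_F_mult[of "\<lambda>_. pi / 2"] F_nonneg
    by (intro nn_integral_eq_integral) (auto simp: mult.commute)
  finally have "ennreal W_int = ennreal (pi / 2 * (LBINT u. F u))" by simp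
  moreover have "W_int \<ge> 0" unfolding W_int_def using W_nonneg
    by (intro Henstock_Kurzweil_Integration.integral_nonneg integrable_continuous_real
        continuous_on_subset[OF W_cont]) auto
  moreover have "(LBINT u. F u) \<ge> 0" using F_nonneg by (intro Bochner_Integration.integral_nonneg)
  ultimately show ?thesis by (simp add: ennreal_inj)
qed

end

subsection \<open>The averaged main term\<close>

lemma sqrt_ratio_eq_kernel:
  assumes "X > 0" "u > 0" "real y < 2 * sqrt (X / u)"
  shows "sqrt (X / u / (4 * (X / u) - real y ^ 2)) = arcsine_kernel (real y / sqrt X * sqrt u)"
proof -
  have "real y ^ 2 < (2 * sqrt (X / u)) ^ 2" using assms by (intro power_strict_mono) auto
  also have "\<dots> = 4 * X / u" using assms by (simp add: power_mult_distrib)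
  finally have lt: "real y ^ 2 * u < 4 * X" using assms by (simp add: pos_less_divide_eq)
  have sq: "(real y / sqrt X)\<^sup>2 * u = real y ^ 2 * u / X" using assms by (simp add: power_divide)
  have lt4: "(real y / sqrt X)\<^sup>2 * u < 4" unfolding sq using lt assms by (simp add: pos_divide_less_eq)
  have "(X / u) / (4 * (X / u) - real y ^ 2) = 1 / (4 - (real y / sqrt X)\<^sup>2 * u)"
    unfolding sq using assms lt by (simp add: field_simps)
  moreover have "arcsine_kernel (real y / sqrt X * sqrt u) = 1 / sqrt (4 - (real y / sqrt X)\<^sup>2 * u)"
    using assms lt4 by (subst arcsine_kernel_scaled) auto
  ultimately show "sqrt ((X / u) / (4 * (X / u) - real y ^ 2)) = arcsine_kernel (real y / sqrt X * sqrt u)"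
    by (simp only: real_sqrt_divide real_sqrt_one)
qed

lemma M_fun_eq:
  assumes X: "X > 0" and u: "u > 0" and N: "real N \<ge> 2 * sqrt (X / u)"
  shows "M_fun (X / u) = c_bar * (11 * zeta_real 2 / (4 * A_const)) *
      (\<Sum>y=1..N. kappa y * arcsine_kernel (real y / sqrt X * sqrt u))
      - 11 * pi / (12 * A_const) * (sqrt X / sqrt u)"
proof -
  let ?C = "11 * zeta_real 2 / (4 * A_const)"
  let ?S = "{y. 1 \<le> y \<and> real y < 2 * sqrt (X / u)}"
  have sub: "?S \<subseteq> {1..N}" using N by auto
  have "(\<Sum>y\<in>?S. ?C * sqrt ((X / u) / (4 * (X / u) - real y ^ 2)) * kappa y)
      = (\<Sum>y\<in>?S. ?C * (kappa y * arcsine_kernel (real y / sqrt X * sqrt u)))"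
    using sqrt_ratio_eq_kernel[OF X u] by (intro sum.cong) (auto simp: mult_ac)
  also have "\<dots> = (\<Sum>y=1..N. ?C * (kappa y * arcsine_kernel (real y / sqrt X * sqrt u)))"
  proof (rule sum.mono_neutral_left[OF _ sub])
    show "\<forall>y\<in>{1..N} - ?S. ?C * (kappa y * arcsine_kernel (real y / sqrt X * sqrt u)) = 0"
    proof
      fix y assume "y \<in> {1..N} - ?S"
      hence "2 * sqrt (X / u) \<le> real y" by auto
      hence "2 * sqrt X \<le> real y * sqrt u" using u by (simp add: real_sqrt_divide pos_divide_le_eq)
      hence "2 \<le> real y / sqrt X * sqrt u" using X by (simp add: pos_le_divide_eq)
      hence "arcsine_kernel (real y / sqrt X * sqrt u) = 0" by (rule arcsine_kernel_eq_0)
      thus "?C * (kappa y * arcsine_kernel (real y / sqrt X * sqrt u)) = 0" by (simp only: mult_zero_right)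
    qed
  qed simp
  also have "\<dots> = ?C * (\<Sum>y=1..N. kappa y * arcsine_kernel (real y / sqrt X * sqrt u))"
    by (rule sum_distrib_left[symmetric])
  finally show ?thesis unfolding M_fun_def by (simp add: real_sqrt_divide)
qed

context compact_weight
begin

text \<open>On the support, \<open>u >= a\<close> gives
  \<open>2 * sqrt (X / u) <= B * sqrt X\<close>. One cutoff \<open>N\<close> thus serves all
  \<open>u\<close>, and a finite sum with fixed range is taken out of the integral.\<close>

lemma integral_M_fun:
  assumes X: "X > 0"
  shows "(LBINT u. M_fun (X / u) * (F u * sqrt u)) =
    c_bar * (11 * zeta_real 2 / (4 * A_const)) * kappa_sum (sqrt X)
    - 11 * pi / (12 * A_const) * sqrt X * (LBINT u. F u)"
proof -
  let ?C = "c_bar * (11 * zeta_real 2 / (4 * A_const))"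
  let ?D = "11 * pi / (12 * A_const) * sqrt X"
  obtain N where N: "real N \<ge> B * sqrt X" using real_arch_simple by blast
  let ?k = "\<lambda>y u. F u * sqrt u * arcsine_kernel (real y / sqrt X * sqrt u)"
  have "M_fun (X / u) * (F u * sqrt u) = ?C * (\<Sum>y=1..N. kappa y * ?k y u) - ?D * F u" for u
  proof (cases "u \<ge> a")
    case True
    hence u: "u > 0" using a_pos by simp
    have "2 * sqrt (X / u) \<le> 2 * sqrt (X / a)"
      using True X a_pos by (intro mult_left_mono real_sqrt_le_mono divide_left_mono) auto
    also have "\<dots> = B * sqrt X" by (simp add: B_def real_sqrt_divide)
    finally have "real N \<ge> 2 * sqrt (X / u)" using N by linarith
    note M = M_fun_eq[OF X u this]
    have "(\<Sum>y=1..N. kappa y * ?k y u)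
        = (\<Sum>y=1..N. kappa y * arcsine_kernel (real y / sqrt X * sqrt u)) * (F u * sqrt u)"
      unfolding sum_distrib_right by (intro sum.cong) (simp_all only: mult_ac)
    moreover have "sqrt X / sqrt u * (F u * sqrt u) = sqrt X * F u" using u by simp
    ultimately show ?thesis by (simp only: M left_diff_distrib mult.assoc)
  qed (simp add: F_zero)
  hence "(LBINT u. M_fun (X / u) * (F u * sqrt u)) = (LBINT u. ?C * (\<Sum>y=1..N. kappa y * ?k y u) - ?D * F u)"
    by simp
  also have "\<dots> = ?C * (\<Sum>y=1..N. kappa y * W (real y / sqrt X)) - ?D * (LBINT u. F u)"
  proof -
    have int: "integrable lborel (\<lambda>u. kappa y * ?k y u)" for y
      using W_integrable[of "real y / sqrt X"] X by simp
    have "integrable lborel F" using integrable_F_mult[of "\<lambda>_. 1"] by simp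
    moreover have "(LBINT u. (\<Sum>y=1..N. kappa y * ?k y u)) = (\<Sum>y=1..N. kappa y * W (real y / sqrt X))"
      by (subst Bochner_Integration.integral_sum) (auto simp only: int W_def integral_mult_right_zero)
    moreover have "integrable lborel (\<lambda>u. ?C * (\<Sum>y=1..N. kappa y * ?k y u))"
      by (intro integrable_mult_right Bochner_Integration.integrable_sum int)
    ultimately show ?thesis
      by (simp only: Bochner_Integration.integral_diff integrable_mult_right integral_mult_right_zero)
  qed
  finally show ?thesis using kappa_sum_upto[OF _ N] X by simp
qed

text \<open>The numbers in \<open>lead\<close> are 11/4 * 2/3 * pi/2 = 11 pi / 12, and in
  \<open>const\<close> they are 11/4 * 8/11 = 2, where \<open>W 0\<close> is half the integral of
  \<open>F u * sqrt u\<close>.\<close>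

lemma integral_M_fun_tendsto:
  "((\<lambda>X. LBINT u. M_fun (X / u) * (F u * sqrt u)) \<longlongrightarrow> - (LBINT u. F u * sqrt u) / 2) at_top"
proof -
  let ?C = "c_bar * (11 * zeta_real 2 / (4 * A_const))"
  have z: "zeta_real 2 \<noteq> 0" using zeta_real_2_pos by simp
  have lead: "?C * (W_int * kappa_mean) = 11 * pi / (12 * A_const) * (LBINT u. F u)"
  proof -
    have "?C * (W_int * kappa_mean) = (c_bar * kappa_mean * zeta_real 2) * (11 / (4 * A_const)) * W_int"
      by simp
    thus ?thesis unfolding c_bar_kappa_mean W_int_eq_pi by (simp add: field_simps)
  qed
  have const: "?C * (- (W 0 / 2 * kappa_total)) = - (LBINT u. F u * sqrt u) / 2"
  proof -
    have "?C * (- (W 0 / 2 * kappa_total)) = - (c_bar * kappa_total * zeta_real 2) * (11 / (4 * A_const)) * (W 0 / 2)"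
      by simp
    thus ?thesis unfolding c_bar_kappa_total W_0 using A_const_nonzero by simp
  qed
  have "((\<lambda>X. ?C * (kappa_sum (sqrt X) - W_int * sqrt X * kappa_mean)) \<longlongrightarrow> ?C * (- (W 0 / 2 * kappa_total))) at_top"
    by (intro tendsto_mult tendsto_const filterlim_compose[OF kappa_sum_asymptotics sqrt_at_top])
  moreover have "\<forall>\<^sub>F X in at_top. ?C * (kappa_sum (sqrt X) - W_int * sqrt X * kappa_mean)
      = (LBINT u. M_fun (X / u) * (F u * sqrt u))"
    using eventually_gt_at_top[of 0]
  proof eventually_elim
    case (elim X)
    have "?C * (W_int * sqrt X * kappa_mean) = 11 * pi / (12 * A_const) * sqrt X * (LBINT u. F u)"
      using arg_cong[OF lead, of "\<lambda>x. x * sqrt X"] by (simp add: mult_ac)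
    thus ?case unfolding integral_M_fun[OF elim] right_diff_distrib by simp
  qed
  ultimately show ?thesis unfolding const by (rule Lim_transform_eventually)
qed

text \<open>If the integral of this nonnegative function vanished, the set where it is nonzero would
  be null; that set is open by continuity, hence empty.\<close>

lemma integral_F_sqrt_pos:
  assumes "F u \<noteq> 0"
  shows "(LBINT u. F u * sqrt u) > 0"
proof -
  have u: "u \<in> {a..b}" using assms F_zero by force
  have cont: "continuous_on {a..b} (\<lambda>u. F u * sqrt u)" by (intro continuous_intros F_cont)
  have nonneg: "F x * sqrt x \<ge> 0" for x
    using F_nonneg F_zero[of x] a_pos by (cases "x \<ge> a") auto
  have int: "integrable lborel (\<lambda>u. F u * sqrt u)"
    by (intro integrable_F_mult continuous_intros)
  have "(LBINT u. F u * sqrt u) \<noteq> 0"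
  proof
    assume "(LBINT u. F u * sqrt u) = 0"
    hence AE: "AE x in lborel. F x * sqrt x = 0"
      using integral_nonneg_eq_0_iff_AE[OF int] nonneg by auto
    have op: "open {x. F x * sqrt x \<noteq> 0}"
      by (intro open_Collect_neq continuous_intros F_cont)
    hence meas: "{x. F x * sqrt x \<noteq> 0} \<in> sets lborel" by simp
    from AE have "{x. F x * sqrt x \<noteq> 0} \<in> null_sets lborel"
      by (subst (asm) AE_iff_null) (use meas in auto)
    hence "negligible {x. F x * sqrt x \<noteq> 0}"
      by (simp add: negligible_iff_null_sets null_sets_completionI)
    hence "{x. F x * sqrt x \<noteq> 0} = {}" using open_not_negligible op by blast
    thus False using assms u a_pos by auto
  qed
  moreover have "(LBINT u. F u * sqrt u) \<ge> 0" by (rule Bochner_Integration.integral_nonneg[OF nonneg])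
  ultimately show ?thesis by linarith
qed

end

text \<open>Since the support has a least element \<open>a > 0\<close>, the extension by zero
  vanishes on \<open>{..<a}\<close>, which overlaps the positive half-line. Differentiability on
  these two open sets therefore gives it on the whole line.\<close>

lemma compact_weight_of_smooth:
  fixes \<Phi> :: "real \<Rightarrow> real"
  assumes nonneg: "\<And>u. u > 0 \<Longrightarrow> \<Phi> u \<ge> 0"
    and smooth: "smooth_on_open {0<..} \<Phi>"
    and supp: "compact_support_pos \<Phi>"
    and nonzero: "\<exists>u>0. \<Phi> u \<noteq> 0"
  obtains F' a b where "compact_weight (\<lambda>u. if u > 0 then \<Phi> u else 0) F' a b"
proof -
  let ?K = "closure {x \<in> {0<..}. \<Phi> x \<noteq> 0}"
  let ?F = "\<lambda>u. if u > 0 then \<Phi> u else 0"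
  have K: "compact ?K" "?K \<subseteq> {0<..}" using supp by (auto simp: compact_support_pos_def)
  have sub: "{x \<in> {0<..}. \<Phi> x \<noteq> 0} \<subseteq> ?K" by (rule closure_subset)
  hence ne: "?K \<noteq> {}" using nonzero by auto
  obtain a where a: "a \<in> ?K" "\<And>x. x \<in> ?K \<Longrightarrow> a \<le> x"
    using compact_attains_inf[OF K(1) ne] by blast
  obtain b where b: "b \<in> ?K" "\<And>x. x \<in> ?K \<Longrightarrow> x \<le> b"
    using compact_attains_sup[OF K(1) ne] by blast
  have a0: "a > 0" using a K by auto
  have zero: "?F u = 0" if "u < a \<or> u > b" for u
    using that a(2)[of u] b(2)[of u] sub by force
  have D0: "\<Phi> differentiable_on {0<..}" and D1: "deriv \<Phi> differentiable_on {0<..}"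
  proof -
    have "(deriv ^^ 0) \<Phi> differentiable_on {0<..}" "(deriv ^^ 1) \<Phi> differentiable_on {0<..}"
      using smooth unfolding smooth_on_open_def by blast+
    thus "\<Phi> differentiable_on {0<..}" "deriv \<Phi> differentiable_on {0<..}" by simp_all
  qed
  have d: "(\<Phi> has_real_derivative deriv \<Phi> u) (at u)" if "u > 0" for u
    using D0 that by (auto simp: differentiable_on_eq_differentiable_at DERIV_deriv_iff_real_differentiable)
  define F' where "F' = deriv ?F"
  have pos: "(?F has_real_derivative deriv \<Phi> u) (at u)" if "u > 0" for u
    by (rule has_field_derivative_transform_within_open[OF d[OF that], of "{0<..}"]) (use that in auto)
  have neg: "(?F has_real_derivative 0) (at u)" if "u < a" for u
    by (rule has_field_derivative_transform_within_open[OF DERIV_const, of "{..<a}" _ 0]) (use that zero in auto)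
  have der: "(?F has_real_derivative F' u) (at u)" for u
    unfolding F'_def using pos[of u] neg[of u] a0 by (cases "u > 0") (auto simp: DERIV_imp_deriv)
  have "continuous_on ({0<..} \<union> {..<a}) F'"
  proof (rule continuous_on_open_Un)
    show "continuous_on {0<..} F'"
      by (rule continuous_on_eq[OF differentiable_imp_continuous_on[OF D1]])
         (auto simp: F'_def DERIV_imp_deriv[OF pos])
    show "continuous_on {..<a} F'"
      by (rule continuous_on_eq[OF continuous_on_const[of _ 0]])
         (auto simp: F'_def DERIV_imp_deriv[OF neg])
  qed auto
  moreover have "{0<..} \<union> {..<a} = UNIV" using a0 by auto
  ultimately have "compact_weight ?F F' a b"
    using a0 a b der zero nonneg by unfold_locales auto
  thus ?thesis by (rule that)
qed

theorem theorem3: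
  fixes \<Phi> :: "real \<Rightarrow> real"
  assumes nonneg: "\<And>u. u > 0 \<Longrightarrow> \<Phi> u \<ge> 0"
    and smooth: "smooth_on_open {0<..} \<Phi>"
    and supp: "compact_support_pos \<Phi>"
    and nonzero: "\<exists>u>0. \<Phi> u \<noteq> 0"
  shows "M_weighted \<Phi> 0 = 0 \<and> (M_weighted \<Phi> \<longlongrightarrow> - 1 / 2) at_top"
proof
  \<comment> \<open>The sum over \<open>y\<close> is empty and \<open>sqrt 0 = 0\<close>; since
    \<open>0 / u = 0\<close>, the integrand of the numerator vanishes identically.\<close>
  have "M_fun 0 = 0" by (simp add: M_fun_def)
  thus "M_weighted \<Phi> 0 = 0" by (simp add: M_weighted_def)
next
  define F where "F = (\<lambda>u. if u > 0 then \<Phi> u else 0)"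
  obtain F' a b where "compact_weight F F' a b"
    using compact_weight_of_smooth[OF assms] unfolding F_def by metis
  then interpret compact_weight F F' a b .
  have powr: "u powr (3 / 2) / u = sqrt u" if "u > 0" for u :: real
    using that powr_diff[of u "3 / 2" 1] by (simp add: powr_half_sqrt)
  have "(LBINT u:{0<..}. \<Phi> u * u powr (3 / 2) / u) = (LBINT u. F u * sqrt u)"
    unfolding set_lebesgue_integral_def
    by (intro Bochner_Integration.integral_cong) (auto simp: F_def indicator_def powr[symmetric])
  moreover have "(LBINT u:{0<..}. M_fun (X / u) * \<Phi> u * u powr (3 / 2) / u)
      = (LBINT u. M_fun (X / u) * (F u * sqrt u))" for X
    unfolding set_lebesgue_integral_def
    by (intro Bochner_Integration.integral_cong) (auto simp: F_def indicator_def powr[symmetric])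
  ultimately have eq: "M_weighted \<Phi> = (\<lambda>X. (LBINT u. M_fun (X / u) * (F u * sqrt u)) / (LBINT u. F u * sqrt u))"
    by (simp add: M_weighted_def fun_eq_iff)
  from nonzero obtain u where "u > 0" "\<Phi> u \<noteq> 0" by blast
  hence "F u \<noteq> 0" by (simp add: F_def)
  hence pos: "(LBINT u. F u * sqrt u) > 0" by (rule integral_F_sqrt_pos)
  have "(M_weighted \<Phi> \<longlongrightarrow> - (LBINT u. F u * sqrt u) / 2 / (LBINT u. F u * sqrt u)) at_top"
    unfolding eq using pos by (intro tendsto_divide integral_M_fun_tendsto tendsto_const) auto
  thus "(M_weighted \<Phi> \<longlongrightarrow> - 1 / 2) at_top" using pos by simp
qed

end
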